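(* Let $T\in\mathcal{CPMM}$ with two Markov partitions $\mathcal P$ and $\mathcal Q$ and corresponding transition matrices $M^{\mathcal P}=(m^{\mathcal P}_{ij})_{i,j\in\mathcal P}$ and $M^{\mathcal Q}=(m^{\mathcal Q}_{ij})_{i,j\in\mathcal Q}$. The matrices $M^{\mathcal P}$ and $M^{\mathcal Q}$ belong to the same class (transient, null recurrent, weakly recurrent, strongly recurrent) of the Vere-Jones classification.
   Context: A continuous map on a closed interval is piecewise monotone if the interval splits into finitely many subintervals on each of which the map is monotone. A Markov partition for a continuous map $T:[0,1]\to[0,1]$ is a finite or countably infinite collection $\mathcal P$ of closed nondegenerate subintervals of $[0,1]$ such that: (1) distinct elements of $\mathcal P$ have disjoint interiors and $[0,1]\setminus\bigcup\mathcal P$ is at most countable; (2) $T|_i$ is monotone for each $i\in\mathcal P$ (classical), or piecewise monotone for each $i\in\mathcal P$ (slack); (3) for all $i,j\in\mathcal P$ and every maximal interval $i'\subset i$ of monotonicity of $T$, if $T(i')\cap j^\circ\ne\emptyset$ then $T(i')\supset j$. $\mathcal{CPMM}$ is the set of continuous maps $T:[0,1]\to[0,1]$ that are topologically mixing (for all nonempty open $U,V$ there is $n$ with $T^m(U)\cap V\neq\emptyset$ for all $m\ge n$), admit a countably infinite Markov partition, and have finite topological entropy. Transition matrix of $T$ with respect to $\mathcal P$: $M=(m_{ij})_{i,j\in\mathcal P}$, where $m_{ij}=0$ if $T(i)\not\supset j$, and otherwise $m_{ij}$ is the maximal number of intervals $i_1,\dots,i_\kappa\subset i$ with pairwise disjoint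 interiors such that each $T|_{i_\ell}$ is monotone and $T(i_\ell)\supset j$ (this number is finite). It is irreducible and aperiodic since $T$ is mixing. Vere-Jones classification of an irreducible nonnegative matrix $M$ with powers $M^n=(m_{ij}(n))$: let $R$ be the common radius of convergence of the series $M_{ij}(z)=\sum_{n\ge0}m_{ij}(n)z^n$ (the Perron value is $\lambda_M=1/R$, assumed finite). Let $f_{ij}(1)=m_{ij}$, $f_{ij}(n+1)=\sum_{\alpha\ne j}m_{i\alpha}f_{\alpha j}(n)$ (number of paths of length $n$ from $i$ to $j$, without $j$ in between, in the graph with $m_{ij}$ edges $i\to j$), $F_{ij}(z)=\sum_{n\ge1}f_{ij}(n)z^n$, with radius of convergence $\Phi_{ij}$. Independently of $i$, $M$ is: transient if $F_{ii}(R)<1$; recurrent if $F_{ii}(R)=1$; null recurrent if $F_{ii}(R)=1$ and $F_{ii}'(R)=\infty$; weakly recurrent if $F_{ii}(R)=1$, $F_{ii}'(R)<\infty$ and $R=\Phi_{ii}$; strongly recurrent if $F_{ii}(R)=1$, $F'_{ii}(R)<\infty$ and $R<\Phi_{ii}$. *)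

theory Defs
  imports "HOL-Analysis.Analysis"
begin

section \<open>Piecewise monotone maps and Markov partitions\<close>

definition monotone_map_on :: "real set \<Rightarrow> (real \<Rightarrow> real) \<Rightarrow> bool" where
  "monotone_map_on S T \<longleftrightarrow> mono_on S T \<or> antimono_on S T"

definition piecewise_monotone_on :: "real set \<Rightarrow> (real \<Rightarrow> real) \<Rightarrow> bool" where
  "piecewise_monotone_on i T \<longleftrightarrow> (\<exists>D. D division_of i \<and> (\<forall>d\<in>D. monotone_map_on d T))"

definition max_monotone_interval :: "(real \<Rightarrow> real) \<Rightarrow> real set \<Rightarrow> real set \<Rightarrow> bool" where
  "max_monotone_interval T i i' \<longleftrightarrow>
     is_interval i' \<and> i' \<subseteq> i \<and> monotone_map_on i' T \<and>
     (\<forall>k. is_interval k \<and> k \<subseteq> i \<and> monotone_map_on k T \<and> i' \<subseteq> k \<longrightarrow> k = i')"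

text \<open>
  The monotonicity requirement on the elements of the partition is a parameter
  \<open>mon\<close>, since partitions come in a classical and a slack version.
\<close>

definition markov_partition_with ::
    "(real set \<Rightarrow> (real \<Rightarrow> real) \<Rightarrow> bool) \<Rightarrow> (real \<Rightarrow> real) \<Rightarrow> real set set \<Rightarrow> bool" where
  "markov_partition_with mon T P \<longleftrightarrow>
     countable P \<and>
     (\<forall>i\<in>P. \<exists>a b. 0 \<le> a \<and> a < b \<and> b \<le> 1 \<and> i = {a..b}) \<and>
     (\<forall>i\<in>P. \<forall>j\<in>P. i \<noteq> j \<longrightarrow> interior i \<inter> interior j = {}) \<and>
     countable ({0..1} - \<Union>P) \<and>
     (\<forall>i\<in>P. mon i T) \<and>
     (\<forall>i\<in>P. \<forall>j\<in>P. \<forall>i'. max_monotone_interval T i i' \<and> T ` i' \<inter> interior j \<noteq> {}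
        \<longrightarrow> j \<subseteq> T ` i')"

definition classical_markov_partition :: "(real \<Rightarrow> real) \<Rightarrow> real set set \<Rightarrow> bool" where
  "classical_markov_partition = markov_partition_with monotone_map_on"

definition slack_markov_partition :: "(real \<Rightarrow> real) \<Rightarrow> real set set \<Rightarrow> bool" where
  "slack_markov_partition = markov_partition_with piecewise_monotone_on"

definition markov_partition :: "(real \<Rightarrow> real) \<Rightarrow> real set set \<Rightarrow> bool" where
  "markov_partition T P \<longleftrightarrow> classical_markov_partition T P \<or> slack_markov_partition T P"


section \<open>Topological mixing and topological entropy\<close>

definition topologically_mixing_on :: "'a::topological_space set \<Rightarrow> ('a \<Rightarrow> 'a) \<Rightarrow> bool" where
  "topologically_mixing_on X T \<longleftrightarrow>
     (\<forall>U V. openin (top_of_set X) U \<and> U \<noteq> {} \<and> openin (top_of_set X) V \<and> V \<noteq> {} \<longrightarrow>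
        (\<exists>n. \<forall>m\<ge>n. (T ^^ m) ` U \<inter> V \<noteq> {}))"

definition separated_set :: "'a::metric_space set \<Rightarrow> ('a \<Rightarrow> 'a) \<Rightarrow> nat \<Rightarrow> real \<Rightarrow> 'a set \<Rightarrow> bool" where
  "separated_set X T n e E \<longleftrightarrow>
     finite E \<and> E \<subseteq> X \<and>
     (\<forall>x\<in>E. \<forall>y\<in>E. x \<noteq> y \<longrightarrow> (\<exists>k<n. dist ((T ^^ k) x) ((T ^^ k) y) > e))"

text \<open>
  Bowen's definition for a continuous map of a compact metric space. The inner supremum is
  \<open>(1/n) ln s(n,e)\<close> with \<open>s(n,e)\<close> the maximal cardinality of an \<open>(n,e)\<close>-separated set; the
  limit as \<open>e\<close> tends to \<open>0\<close> is a supremum because \<open>s(n,e)\<close> is antitone in \<open>e\<close>.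
\<close>

definition topological_entropy :: "'a::metric_space set \<Rightarrow> ('a \<Rightarrow> 'a) \<Rightarrow> ereal" where
  "topological_entropy X T =
     (SUP e\<in>{0<..}. limsup (\<lambda>n. SUP E\<in>{E. separated_set X T n e E}.
        ereal (ln (real (card E)) / real n)))"


text \<open>
  A self-map of the unit interval is represented by a function on the reals, of which only the
  restriction to \<open>{0..1}\<close> matters.
\<close>

definition CPMM :: "(real \<Rightarrow> real) set" where
  "CPMM = {T. continuous_on {0..1} T \<and> T ` {0..1} \<subseteq> {0..1} \<and>
     topologically_mixing_on {0..1} T \<and>
     (\<exists>P. markov_partition T P \<and> infinite P) \<and>
     topological_entropy {0..1} T < \<infinity>}"


section \<open>Transition matrices\<close>

text \<open>
  A family of intervals covering a nondegenerate \<open>j\<close> with pairwise disjoint interiors has no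
  repetitions, so it can be taken to be a set \<open>C\<close>. For Markov partitions of mixing maps the
  cardinalities below are bounded, so that \<open>Max\<close> is meaningful.
\<close>

definition transition_matrix :: "(real \<Rightarrow> real) \<Rightarrow> real set \<Rightarrow> real set \<Rightarrow> nat" where
  "transition_matrix T i j =
     (if j \<subseteq> T ` i
      then Max {card C | C. finite C \<and>
             (\<forall>c\<in>C. is_interval c \<and> c \<subseteq> i \<and> monotone_map_on c T \<and> j \<subseteq> T ` c) \<and>
             (\<forall>c\<in>C. \<forall>d\<in>C. c \<noteq> d \<longrightarrow> interior c \<inter> interior d = {})}
      else 0)"


section \<open>The Vere-Jones classification\<close>

text \<open>
  Matrices are indexed by a set \<open>I\<close>. Everything is computed in \<open>ennreal\<close>, so that the
  possibly infinite sums and the values of power series on the nonnegative axis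
  are always defined, without any summability convention.
\<close>

primrec mat_power :: "'a set \<Rightarrow> ('a \<Rightarrow> 'a \<Rightarrow> ennreal) \<Rightarrow> nat \<Rightarrow> 'a \<Rightarrow> 'a \<Rightarrow> ennreal" where
  "mat_power I M 0 i j = (if i = j then 1 else 0)"
| "mat_power I M (Suc n) i j = (\<Sum>\<^sub>\<infinity>\<alpha>\<in>I. M i \<alpha> * mat_power I M n \<alpha> j)"

fun first_entrance :: "'a set \<Rightarrow> ('a \<Rightarrow> 'a \<Rightarrow> ennreal) \<Rightarrow> nat \<Rightarrow> 'a \<Rightarrow> 'a \<Rightarrow> ennreal" where
  "first_entrance I M 0 i j = 0"
| "first_entrance I M (Suc 0) i j = M i j"
| "first_entrance I M (Suc (Suc n)) i j =
     (\<Sum>\<^sub>\<infinity>\<alpha>\<in>I - {j}. M i \<alpha> * first_entrance I M (Suc n) \<alpha> j)"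

definition power_series :: "(nat \<Rightarrow> ennreal) \<Rightarrow> ennreal \<Rightarrow> ennreal" where
  "power_series a z = (\<Sum>n. a n * z ^ n)"

text \<open>
  The termwise derivative; at the radius of convergence its value is the (possibly infinite)
  left limit of the derivative.
\<close>

definition power_series_deriv :: "(nat \<Rightarrow> ennreal) \<Rightarrow> ennreal \<Rightarrow> ennreal" where
  "power_series_deriv a z = (\<Sum>n. of_nat (Suc n) * a (Suc n) * z ^ n)"

definition convergence_radius :: "(nat \<Rightarrow> ennreal) \<Rightarrow> ennreal" where
  "convergence_radius a = (SUP z\<in>{z. power_series a z < \<infinity>}. z)"

text \<open>For finite coefficients this is the library's radius of convergence.\<close>

lemma convergence_radius_eq_conv_radius:
  fixes a :: "nat \<Rightarrow> real"
  assumes nn: "\<And>n. a n \<ge> 0"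
  shows "enn2ereal (convergence_radius (\<lambda>n. ennreal (a n))) = conv_radius a"
proof -
  let ?p = "power_series (\<lambda>n. ennreal (a n))"
  let ?c = "convergence_radius (\<lambda>n. ennreal (a n))"
  have conv: "?p (ennreal r) < \<infinity> \<longleftrightarrow> summable (\<lambda>n. a n * r ^ n)" if "r \<ge> 0" for r
  proof -
    have eq: "?p (ennreal r) = (\<Sum>n. ennreal (a n * r ^ n))"
      unfolding power_series_def using that nn by (simp add: ennreal_mult ennreal_power)
    have nn': "0 \<le> a n * r ^ n" for n
      using that nn by simp
    show ?thesis
    proof
      assume "?p (ennreal r) < \<infinity>"
      then show "summable (\<lambda>n. a n * r ^ n)"
        unfolding eq by (intro summable_suminf_not_top nn') auto
    next
      assume "summable (\<lambda>n. a n * r ^ n)"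
      then show "?p (ennreal r) < \<infinity>"
        unfolding eq by (subst suminf_ennreal2[OF nn']) auto
    qed
  qed
  show ?thesis
  proof (rule antisym)
    show "enn2ereal ?c \<le> conv_radius a"
    proof (rule ccontr)
      assume "\<not> ?thesis"
      then have "conv_radius a < enn2ereal ?c" by simp
      then obtain r where r: "conv_radius a < ereal r" "ereal r < enn2ereal ?c"
        using ereal_dense2 by blast
      have "0 < ereal r"
        using conv_radius_nonneg[of a] r(1) by (rule le_less_trans)
      then have r0: "r \<ge> 0" by simp
      have "ennreal r < ?c"
        unfolding less_ennreal.rep_eq using r(2) r0 by (simp add: enn2ereal_ennreal)
      then obtain z where z: "?p z < \<infinity>" "ennreal r < z"
        unfolding convergence_radius_def less_SUP_iff by auto
      have "?p (ennreal r) \<le> ?p z"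
        unfolding power_series_def
        by (intro suminf_le mult_left_mono power_mono) (use z(2) in auto)
      with z(1) have "?p (ennreal r) < \<infinity>"
        by (rule le_less_trans[rotated])
      then have "summable (\<lambda>n. a n * r ^ n)"
        using conv[OF r0] by simp
      then have "conv_radius a \<ge> norm r"
        by (rule conv_radius_geI)
      with r(1) r0 show False by simp
    qed
  next
    show "conv_radius a \<le> enn2ereal ?c"
    proof (rule ccontr)
      assume "\<not> ?thesis"
      then have "enn2ereal ?c < conv_radius a" by simp
      then obtain r where r: "enn2ereal ?c < ereal r" "ereal r < conv_radius a"
        using ereal_dense2 by blast
      have "0 < ereal r"
        using enn2ereal_nonneg r(1) by (rule le_less_trans)
      then have r0: "r \<ge> 0" by simp
      have "summable (\<lambda>n. a n * r ^ n)"
        using r(2) r0 by (intro summable_in_conv_radius) simp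
      then have "ennreal r \<le> ?c"
        unfolding convergence_radius_def using conv[OF r0] by (intro SUP_upper) simp
      then have "ereal r \<le> enn2ereal ?c"
        using r0 by (simp add: less_eq_ennreal.rep_eq enn2ereal_ennreal)
      with r(1) show False by simp
    qed
  qed
qed

definition vj_radius :: "'a set \<Rightarrow> ('a \<Rightarrow> 'a \<Rightarrow> ennreal) \<Rightarrow> 'a \<Rightarrow> 'a \<Rightarrow> ennreal" where
  "vj_radius I M i j = convergence_radius (\<lambda>n. mat_power I M n i j)"

definition vj_F :: "'a set \<Rightarrow> ('a \<Rightarrow> 'a \<Rightarrow> ennreal) \<Rightarrow> 'a \<Rightarrow> 'a \<Rightarrow> ennreal \<Rightarrow> ennreal" where
  "vj_F I M i j = power_series (\<lambda>n. first_entrance I M n i j)"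

definition vj_F_deriv :: "'a set \<Rightarrow> ('a \<Rightarrow> 'a \<Rightarrow> ennreal) \<Rightarrow> 'a \<Rightarrow> 'a \<Rightarrow> ennreal \<Rightarrow> ennreal" where
  "vj_F_deriv I M i j = power_series_deriv (\<lambda>n. first_entrance I M n i j)"

definition vj_Phi :: "'a set \<Rightarrow> ('a \<Rightarrow> 'a \<Rightarrow> ennreal) \<Rightarrow> 'a \<Rightarrow> 'a \<Rightarrow> ennreal" where
  "vj_Phi I M i j = convergence_radius (\<lambda>n. first_entrance I M n i j)"

datatype vj_class = Transient | Null_Recurrent | Weakly_Recurrent | Strongly_Recurrent

text \<open>
  For irreducible \<open>M\<close> the radius \<open>R\<close> does not depend on the pair of indices, and the class
  does not depend on \<open>i\<close>; the condition is required at every \<open>i\<close>.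
\<close>

definition belongs_to_class :: "'a set \<Rightarrow> ('a \<Rightarrow> 'a \<Rightarrow> ennreal) \<Rightarrow> vj_class \<Rightarrow> bool" where
  "belongs_to_class I M c \<longleftrightarrow>
     (\<forall>i\<in>I. let R = vj_radius I M i i; F = vj_F I M i i R; F' = vj_F_deriv I M i i R;
               Phi = vj_Phi I M i i
       in case c of
            Transient \<Rightarrow> F < 1
          | Null_Recurrent \<Rightarrow> F = 1 \<and> F' = \<infinity>
          | Weakly_Recurrent \<Rightarrow> F = 1 \<and> F' < \<infinity> \<and> R = Phi
          | Strongly_Recurrent \<Rightarrow> F = 1 \<and> F' < \<infinity> \<and> R < Phi)"

end

theory Submission
  imports Defs
begin

text \<open>
  Backward orbits of points in interiors of partition elements stay in such interiors. Hence for
  \<open>U = interior i\<close> and any \<open>y \<in> U\<close> the entries \<open>m\<^bsub>ii\<^esub>(n)\<close> and \<open>f\<^bsub>ii\<^esub>(n)\<close> count the points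
  \<open>x \<in> U\<close> with \<open>T\<^sup>n x = y\<close>, respectively those for which \<open>n\<close> is the first return time to \<open>U\<close>.
  Splitting orbits at their returns gives \<open>A = (\<Sum>s. F\<^sup>s)\<close> for the two generating functions.

  Let \<open>V\<close> be the interior of an element of the other partition. By mixing, \<open>V\<close> lies in some
  \<open>T\<^sup>k(U)\<close> and \<open>U\<close> in some \<open>T\<^sup>l(V)\<close>, so \<open>A\<^sub>U\<close> and \<open>A\<^sub>V\<close> bound each other up to powers of \<open>z\<close>.
  This gives equal radii \<open>R\<close> and, as \<open>A = 1/(1 - F)\<close>, determines whether \<open>F(R) = 1\<close> and
  whether \<open>F'(R)\<close>, the limit of \<open>(1 - F(z))/(R - z)\<close>, is finite.

  For strong recurrence, choose \<open>C \<subseteq> U\<close> that passes through \<open>V\<close> and is mapped onto \<open>U\<close> by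
  \<open>T\<^sup>p\<close>, with \<open>s\<close> visits to \<open>U\<close> on the way. If \<open>F\<^sub>U\<close> converges beyond \<open>R\<close>, then
  \<open>F\<^sub>U(z)\<^sup>s - z\<^sup>p/2 < 1\<close> for some \<open>z > R\<close>, so the orbits of \<open>U\<close>, weighted by \<open>1/2\<close> for each
  visit to \<open>C\<close>, have a generating function that is finite at \<open>z\<close>. First returns to \<open>V\<close> meet \<open>C\<close> a
  bounded number of times, so \<open>F\<^sub>V\<close> converges at \<open>z\<close> as well.
\<close>

section \<open>Power series with coefficients in the extended nonnegative reals\<close>

lemma power_series_mono: "z \<le> z' \<Longrightarrow> power_series a z \<le> power_series a z'"
  unfolding power_series_def by (intro suminf_le mult_left_mono power_mono) auto

lemma power_series_0: "power_series a 0 = a 0"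
  unfolding power_series_def by (subst suminf_finite[of "{0}"]) auto

lemma power_series_eq_top_if_gt_radius:
  "convergence_radius a < z \<Longrightarrow> power_series a z = \<infinity>"
proof (rule ccontr)
  assume "convergence_radius a < z" "power_series a z \<noteq> \<infinity>"
  then have "z \<le> convergence_radius a"
    unfolding convergence_radius_def by (intro SUP_upper) (auto simp: less_top[symmetric])
  with \<open>convergence_radius a < z\<close> show False by simp
qed

lemma power_series_finite_if_lt_radius:
  assumes "z < convergence_radius a"
  shows "power_series a z < \<infinity>"
proof -
  obtain z' where "power_series a z' < \<infinity>" "z < z'"
    using assms unfolding convergence_radius_def less_SUP_iff by auto
  then show ?thesis
    using power_series_mono[of z z' a] by (meson le_less_trans less_imp_le)
qed

lemma radius_ge_if_power_series_finite:
  "power_series a z < \<infinity> \<Longrightarrow> z \<le> convergence_radius a"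
  using power_series_eq_top_if_gt_radius[of a z] by (cases "z \<le> convergence_radius a") auto

lemma geometric_ennreal:
  fixes r :: ennreal
  assumes "r < 1"
  shows "(\<Sum>n. r ^ n) * (1 - r) = 1"
proof -
  obtain x where x: "r = ennreal x" "0 \<le> x" "x < 1"
    using assms by (cases r) (auto simp: ennreal_less_one_iff)
  have "(\<Sum>n. r ^ n) = (\<Sum>n. ennreal (x ^ n))"
    using x by (simp add: ennreal_power)
  also have "\<dots> = ennreal (1 / (1 - x))"
    using x by (subst suminf_ennreal2) (auto simp: suminf_geometric)
  finally have "(\<Sum>n. r ^ n) * (1 - r) = ennreal (1 / (1 - x)) * ennreal (1 - x)"
    using x by (simp add: ennreal_minus flip: ennreal_1)
  then show ?thesis
    using x by (simp flip: ennreal_mult)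
qed

lemma geometric_ennreal_finite_iff:
  fixes r :: ennreal
  shows "(\<Sum>n. r ^ n) < \<infinity> \<longleftrightarrow> r < 1"
proof
  assume "r < 1"
  then have "(\<Sum>n. r ^ n) * (1 - r) = 1" "1 - r \<noteq> 0"
    by (auto simp: geometric_ennreal diff_eq_0_iff_ennreal)
  then show "(\<Sum>n. r ^ n) < \<infinity>"
    by (auto simp: less_top[symmetric] ennreal_top_mult)
next
  show "r < 1" if "(\<Sum>n. r ^ n) < \<infinity>"
  proof (rule ccontr)
    assume "\<not> r < 1"
    then have "(\<Sum>n. 1::ennreal) \<le> (\<Sum>n. r ^ n)"
      by (intro suminf_le) (auto intro: one_le_power)
    moreover have "(\<Sum>n. 1::ennreal) = \<infinity>"
      using nn_integral_count_space_nat[of "\<lambda>_. 1"] by simp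
    ultimately show False
      using that by simp
  qed
qed

text \<open>Since \<open>A (1 - F) = 1\<close> below the radius, everything in the classification except the
  comparison of \<open>R\<close> and \<open>\<Phi>\<close> is determined by the growth of \<open>A\<close> near \<open>R\<close>.\<close>

definition renewal_pair :: "(nat \<Rightarrow> ennreal) \<Rightarrow> (nat \<Rightarrow> ennreal) \<Rightarrow> bool" where
  "renewal_pair a f \<longleftrightarrow> f 0 = 0 \<and> power_series a 1 = \<infinity> \<and>
     (\<forall>z. power_series a z = (\<Sum>s. power_series f z ^ s))"

text \<open>A fixed sequence increasing to 1 turns left limits at \<open>R\<close> into countable
  suprema over the points \<open>approach_one k * R\<close>, so that monotone convergence applies.
  The bound 1/2 keeps these points at least \<open>R / 2\<close>.\<close>

definition approach_one :: "nat \<Rightarrow> real" where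
  "approach_one k = 1 - 1 / (real k + 2)"

lemma approach_one_bounds: "1 / 2 \<le> approach_one k" "approach_one k < 1"
  by (auto simp: approach_one_def field_simps)

lemma approach_one_mono: "k \<le> l \<Longrightarrow> approach_one k \<le> approach_one l"
  by (auto simp: approach_one_def intro!: divide_left_mono)

lemma approach_one_tendsto: "approach_one \<longlonglongrightarrow> 1"
proof -
  have "(\<lambda>k. 1 - 1 / real (k + 2)) \<longlonglongrightarrow> 1 - 0"
    by (intro tendsto_diff tendsto_const LIMSEQ_ignore_initial_segment lim_1_over_n)
  then show ?thesis by (simp add: approach_one_def[abs_def] add.commute)
qed

lemma SUP_polynomial_approach_one:
  fixes g :: "real \<Rightarrow> real"
  assumes "continuous_on {0..1} g" "\<And>x y. 0 \<le> x \<Longrightarrow> x \<le> y \<Longrightarrow> y \<le> 1 \<Longrightarrow> g x \<le> g y"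
  shows "(SUP k. ennreal (g (approach_one k))) = ennreal (g 1)"
    and "incseq (\<lambda>k. ennreal (g (approach_one k)))"
proof -
  have b: "0 \<le> approach_one k \<and> approach_one k \<le> 1" for k
    using approach_one_bounds[of k] by simp
  show inc: "incseq (\<lambda>k. ennreal (g (approach_one k)))"
    using b by (auto simp: incseq_def intro!: ennreal_leI assms(2) approach_one_mono)
  have "(\<lambda>k. g (approach_one k)) \<longlonglongrightarrow> g 1"
    using b by (intro continuous_on_tendsto_compose[OF assms(1) approach_one_tendsto]) auto
  then have "(\<lambda>k. ennreal (g (approach_one k))) \<longlonglongrightarrow> ennreal (g 1)"
    by simp
  with LIMSEQ_SUP[OF inc] show "(SUP k. ennreal (g (approach_one k))) = ennreal (g 1)"
    by (rule LIMSEQ_unique)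
qed

text \<open>Monotone convergence. It is applied to powers for the series itself and to finite
  geometric sums for its difference quotients.\<close>

lemma SUP_suminf_approach_one:
  fixes c :: "nat \<Rightarrow> ennreal" and g :: "nat \<Rightarrow> real \<Rightarrow> real"
  assumes "\<And>n. continuous_on {0..1} (g n)"
    and "\<And>n x y. 0 \<le> x \<Longrightarrow> x \<le> y \<Longrightarrow> y \<le> 1 \<Longrightarrow> g n x \<le> g n y"
  shows "(SUP k. \<Sum>n. c n * ennreal (g n (approach_one k))) = (\<Sum>n. c n * ennreal (g n 1))"
proof -
  have "incseq (\<lambda>k. c n * ennreal (g n (approach_one k)))" for n
    using SUP_polynomial_approach_one(2)[OF assms, of n]
    by (auto simp: incseq_def intro!: mult_left_mono)
  then have "(SUP k. \<Sum>n. c n * ennreal (g n (approach_one k)))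
      = (\<Sum>n. SUP k. c n * ennreal (g n (approach_one k)))"
    by (intro ennreal_suminf_SUP_eq[symmetric])
  also have "\<dots> = (\<Sum>n. c n * ennreal (g n 1))"
    by (simp add: SUP_mult_left_ennreal[symmetric] SUP_polynomial_approach_one(1)[OF assms])
  finally show ?thesis .
qed

text \<open>Left continuity, also where the value is infinite: Abel's limit theorem for nonnegative
  coefficients.\<close>

lemma power_series_SUP:
  "power_series f R = (SUP k. power_series f (ennreal (approach_one k) * R))"
proof -
  have "0 \<le> approach_one k" for k
    using approach_one_bounds(1)[of k] by simp
  then have "(SUP k. power_series f (ennreal (approach_one k) * R))
      = (SUP k. \<Sum>n. f n * R ^ n * ennreal (approach_one k ^ n))"
    by (simp add: power_series_def power_mult_distrib mult_ac flip: ennreal_power)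
  also have "\<dots> = (\<Sum>n. f n * R ^ n * ennreal (1 ^ n))"
    by (rule SUP_suminf_approach_one) (auto intro!: continuous_intros power_mono)
  finally show ?thesis by (simp add: power_series_def)
qed

text \<open>The factorization of \<open>1 - q ^ n\<close>, arranged as a sum to avoid truncated
  subtraction in \<open>ennreal\<close>.\<close>

lemma power_diff_ennreal:
  assumes "0 \<le> q" "q \<le> 1"
  shows "ennreal (q ^ n) + ennreal (1 - q) * ennreal (\<Sum>k<n. q ^ k) = 1"
proof -
  have "q ^ n + (1 - q) * (\<Sum>k<n. q ^ k) = 1"
    using one_diff_power_eq[of q n] by simp
  then show ?thesis
    using assms by (simp add: sum_nonneg flip: ennreal_mult ennreal_plus)
qed

text \<open>The difference quotients of \<open>F\<close> at \<open>R\<close> increase to \<open>F'(R)\<close>.\<close>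

lemma power_series_deriv_SUP:
  assumes "power_series f R = 1"
  shows "R * power_series_deriv f R =
    (SUP k. (1 - power_series f (ennreal (approach_one k) * R)) / ennreal (1 - approach_one k))"
proof -
  define c where "c n = f n * R ^ n" for n
  \<comment> \<open>For \<open>q < 1\<close> this is the difference quotient of the series at
    \<open>R\<close>; at \<open>q = 1\<close> it is the sum of \<open>n * c n\<close>, which is
    \<open>R\<close> times the derivative. Its terms increase with \<open>q\<close>.\<close>
  let ?D = "\<lambda>q. \<Sum>n. c n * ennreal (\<Sum>k<n. q ^ k)"
  have sum: "(\<Sum>n. c n) = 1"
    using assms by (simp add: power_series_def c_def)
  have D: "?D q = (1 - power_series f (ennreal q * R)) / ennreal (1 - q)"
    if "0 \<le> q" "q < 1" for q
  proof -
    have C: "power_series f (ennreal q * R) = (\<Sum>n. c n * ennreal (q ^ n))"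
      using that by (simp add: power_series_def c_def power_mult_distrib mult_ac flip: ennreal_power)
    have "(\<Sum>n. c n * ennreal (q ^ n)) + ennreal (1 - q) * ?D q
        = (\<Sum>n. c n * (ennreal (q ^ n) + ennreal (1 - q) * ennreal (\<Sum>k<n. q ^ k)))"
      by (subst ennreal_suminf_cmult[symmetric], subst suminf_add)
         (auto intro!: suminf_cong simp: algebra_simps)
    also have "\<dots> = 1"
      using that by (simp add: power_diff_ennreal sum)
    finally have eq: "(\<Sum>n. c n * ennreal (q ^ n)) + ennreal (1 - q) * ?D q = 1" .
    then have "(\<Sum>n. c n * ennreal (q ^ n)) \<noteq> \<infinity>" by auto
    with eq have "1 - (\<Sum>n. c n * ennreal (q ^ n)) = ennreal (1 - q) * ?D q"
      by (metis ennreal_add_diff_cancel_left infinity_ennreal_def)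
    then show ?thesis
      using that unfolding C
      by (metis (no_types, lifting) diff_gt_0_iff_gt ennreal_eq_0_iff ennreal_neq_top
          ennreal_mult_divide_eq mult.commute not_le)
  qed
  have "R * power_series_deriv f R = (\<Sum>n. of_nat (Suc n) * c (Suc n))"
    by (simp add: power_series_deriv_def c_def mult_ac flip: ennreal_suminf_cmult)
  also have "\<dots> = (\<Sum>n. of_nat n * c n)"
    by (subst (2) suminf_offset[of _ 1]) auto
  also have "\<dots> = (\<Sum>n. c n * ennreal (\<Sum>k<n. 1 ^ k))"
    by (simp add: mult.commute ennreal_of_nat_eq_real_of_nat)
  also have "\<dots> = (SUP k. ?D (approach_one k))"
    by (rule SUP_suminf_approach_one[symmetric])
       (auto intro!: continuous_intros sum_mono power_mono)
  also have "\<dots> = (SUP k. (1 - power_series f (ennreal (approach_one k) * R)) / ennreal (1 - approach_one k))"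
    using approach_one_bounds by (intro SUP_cong D refl) (auto intro: order_trans[of _ "1 / 2"])
  finally show ?thesis .
qed

lemma approach_radius:
  assumes "0 < R" "R \<le> (1::ennreal)"
  shows "ennreal (approach_one k) * R < R"
  using assms approach_one_bounds[of k]
  by (cases R) (auto simp: ennreal_less_iff top_unique simp flip: ennreal_mult)

context
  fixes a f :: "nat \<Rightarrow> ennreal"
  assumes renewal: "renewal_pair a f"
begin

lemma renewal_finite_iff: "power_series a z < \<infinity> \<longleftrightarrow> power_series f z < 1"
  using renewal geometric_ennreal_finite_iff by (simp add: renewal_pair_def)

lemma renewal_equation: "power_series f z < 1 \<Longrightarrow> power_series a z * (1 - power_series f z) = 1"
  using renewal geometric_ennreal by (simp add: renewal_pair_def)

text \<open>A renewal pair has \<open>power_series a 1 = \<infinity>\<close>. In particular the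
  radius is finite.\<close>

lemma renewal_radius_le_1: "convergence_radius a \<le> 1"
proof (rule leI, rule notI)
  assume "1 < convergence_radius a"
  from power_series_finite_if_lt_radius[OF this] renewal show False
    unfolding renewal_pair_def by (metis less_irrefl)
qed

lemma renewal_lt_1_if_lt_radius: "z < convergence_radius a \<Longrightarrow> power_series f z < 1"
  using renewal_finite_iff power_series_finite_if_lt_radius by blast

text \<open>Below the radius the value is less than 1, and the bound passes to the radius by left
  continuity. A zero radius is treated apart because it cannot be approached from below.\<close>

lemma renewal_le_1_at_radius: "power_series f (convergence_radius a) \<le> 1"
proof (cases "convergence_radius a = 0")
  case True
  then have "power_series f (convergence_radius a) = 0"
    using renewal by (simp add: power_series_0 renewal_pair_def)
  then show ?thesis by simp
next
  case False
  then have "ennreal (approach_one k) * convergence_radius a < convergence_radius a" for k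
    by (intro approach_radius renewal_radius_le_1) (simp add: zero_less_iff_neq_zero)
  then show ?thesis
    by (subst power_series_SUP) (intro SUP_least less_imp_le renewal_lt_1_if_lt_radius)
qed

lemma renewal_radius_le_Phi: "convergence_radius a \<le> convergence_radius f"
  by (intro radius_ge_if_power_series_finite le_less_trans[OF renewal_le_1_at_radius]) simp

lemma renewal_radius_nonzero: "power_series f (convergence_radius a) = 1 \<Longrightarrow> convergence_radius a \<noteq> 0"
  using renewal power_series_0[of f] by (intro notI) (simp add: renewal_pair_def)

end

section \<open>The Vere-Jones class of a renewal pair and its invariance\<close>

definition vj_type :: "(nat \<Rightarrow> ennreal) \<Rightarrow> (nat \<Rightarrow> ennreal) \<Rightarrow> vj_class \<Rightarrow> bool" where
  "vj_type a f c \<longleftrightarrow>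
    (let R = convergence_radius a; F = power_series f R; F' = power_series_deriv f R;
         Phi = convergence_radius f
     in case c of
          Transient \<Rightarrow> F < 1
        | Null_Recurrent \<Rightarrow> F = 1 \<and> F' = \<infinity>
        | Weakly_Recurrent \<Rightarrow> F = 1 \<and> F' < \<infinity> \<and> R = Phi
        | Strongly_Recurrent \<Rightarrow> F = 1 \<and> F' < \<infinity> \<and> R < Phi)"

lemma belongs_to_class_iff_vj_type:
  "belongs_to_class I M c \<longleftrightarrow>
     (\<forall>i\<in>I. vj_type (\<lambda>n. mat_power I M n i i) (\<lambda>n. first_entrance I M n i i) c)"
  by (simp add: belongs_to_class_def vj_type_def vj_radius_def vj_F_def vj_F_deriv_def vj_Phi_def)

text \<open>\<open>F(R) \<le> 1\<close> and \<open>R \<le> \<Phi>\<close> leave exactly the four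
  alternatives of the classification.\<close>

lemma vj_type_exists:
  assumes "renewal_pair a f"
  shows "\<exists>c. vj_type a f c"
proof -
  let ?R = "convergence_radius a"
  consider "power_series f ?R < 1" | "power_series f ?R = 1" "power_series_deriv f ?R = \<infinity>"
    | "power_series f ?R = 1" "power_series_deriv f ?R < \<infinity>" "?R = convergence_radius f"
    | "power_series f ?R = 1" "power_series_deriv f ?R < \<infinity>" "?R < convergence_radius f"
    using renewal_le_1_at_radius[OF assms] renewal_radius_le_Phi[OF assms]
    unfolding le_less less_top[symmetric] infinity_ennreal_def by blast
  then show ?thesis
    by cases (force simp: vj_type_def Let_def split: vj_class.split)+
qed

text \<open>For \<open>z \<noteq> 0\<close> the factor \<open>z ^ L\<close> is nonzero and does not
  affect whether the left side is finite.\<close>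

lemma radius_le_if_dominated:
  assumes "\<And>z. z ^ L * power_series a z \<le> power_series b z"
  shows "convergence_radius b \<le> convergence_radius a"
  unfolding convergence_radius_def[of b]
proof (rule SUP_least)
  fix z assume z: "z \<in> {z. power_series b z < \<infinity>}"
  show "z \<le> convergence_radius a"
  proof (cases "z = 0")
    case False
    have "z ^ L * power_series a z < \<infinity>"
      using assms[of z] z by (auto intro: le_less_trans)
    with False have "power_series a z < \<infinity>"
      by (auto simp: less_top[symmetric] ennreal_mult_eq_top_iff)
    then show ?thesis by (rule radius_ge_if_power_series_finite)
  qed simp
qed

context
  fixes a f b g :: "nat \<Rightarrow> ennreal" and L :: nat
  assumes af: "renewal_pair a f" and bg: "renewal_pair b g"
    and dom: "\<And>z. z ^ L * power_series a z \<le> power_series b z"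
    and same_radius: "convergence_radius a = convergence_radius b"
begin

text \<open>If the value of \<open>g\<close> at \<open>R\<close> were below 1, the series of
  \<open>b\<close> and hence that of \<open>a\<close> would be finite at \<open>R\<close>, which
  contradicts the recurrence of \<open>f\<close>.\<close>

lemma dominated_recurrent:
  assumes "power_series f (convergence_radius a) = 1"
  shows "power_series g (convergence_radius b) = 1"
proof (rule ccontr)
  let ?R = "convergence_radius a"
  assume "power_series g (convergence_radius b) \<noteq> 1"
  with renewal_le_1_at_radius[OF bg] have "power_series g ?R < 1"
    by (simp add: same_radius le_less)
  then have "power_series b ?R < \<infinity>"
    by (simp only: renewal_finite_iff[OF bg])
  with dom[of ?R] have "?R ^ L * power_series a ?R < \<infinity>"
    by (rule le_less_trans)
  moreover have "?R \<noteq> 0"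
    using renewal_radius_nonzero[OF af assms] .
  ultimately have "power_series a ?R < \<infinity>"
    by (auto simp: less_top[symmetric] ennreal_mult_eq_top_iff)
  then show False
    using assms by (simp only: renewal_finite_iff[OF af])
qed

text \<open>Below the radius both series are reciprocals, so the domination turns into
  \<open>z ^ L * (1 - G(z)) \<le> 1 - F(z)\<close>. The difference quotients of \<open>g\<close> at
  \<open>R\<close> are thus bounded by a multiple of those of \<open>f\<close>.\<close>

lemma dominated_deriv_finite:
  assumes "power_series f (convergence_radius a) = 1"
    and "power_series_deriv f (convergence_radius a) < \<infinity>"
  shows "power_series_deriv g (convergence_radius b) < \<infinity>"
proof -
  define R where "R = convergence_radius a"
  have R: "R \<noteq> 0" "R \<le> 1"
    unfolding R_def using renewal_radius_nonzero[OF af assms(1)] renewal_radius_le_1[OF af] .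
  then have R': "0 < R" "R < \<infinity>"
    by (auto simp: zero_less_iff_neq_zero less_top[symmetric] top_unique)
  \<comment> \<open>A lower bound for \<open>z ^ L\<close> at all points
    \<open>z = approach_one k * R\<close>, which are at least \<open>R / 2\<close>.\<close>
  define C where "C = (ennreal (1 / 2) * R) ^ L"
  have C: "C \<noteq> 0"
    using R by (simp add: C_def)
  define F where "F k = 1 - power_series f (ennreal (approach_one k) * R)" for k
  define G where "G k = 1 - power_series g (ennreal (approach_one k) * R)" for k
  have le: "C * G k \<le> F k" for k
  proof -
    let ?z = "ennreal (approach_one k) * R"
    have "?z < R"
      using approach_radius R' R by blast
    then have f: "power_series f ?z < 1" and g: "power_series g ?z < 1"
      using renewal_lt_1_if_lt_radius[OF af] renewal_lt_1_if_lt_radius[OF bg]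
      by (auto simp: R_def same_radius)
    \<comment> \<open>The renewal equation of \<open>a\<close> inserts a factor 1, and that of
      \<open>b\<close> removes one at the end.\<close>
    have "C * G k = C * G k * (power_series a ?z * F k)"
      using renewal_equation[OF af f] by (simp add: F_def)
    also have "\<dots> = C * power_series a ?z * (G k * F k)"
      by (simp add: mult_ac)
    also have "\<dots> \<le> ?z ^ L * power_series a ?z * (G k * F k)"
      unfolding C_def using approach_one_bounds[of k]
      by (intro mult_right_mono power_mono ennreal_leI) auto
    also have "\<dots> \<le> power_series b ?z * (G k * F k)"
      by (intro mult_right_mono dom) auto
    also have "\<dots> = F k"
      using renewal_equation[OF bg g] by (simp add: G_def mult.assoc[symmetric])
    finally show ?thesis .
  qed
  have "C * (R * power_series_deriv g R) = (SUP k. C * (G k / ennreal (1 - approach_one k)))"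
    using power_series_deriv_SUP dominated_recurrent[OF assms(1)]
    by (simp add: R_def same_radius G_def SUP_mult_left_ennreal)
  also have "\<dots> \<le> (SUP k. F k / ennreal (1 - approach_one k))"
    using le by (intro SUP_mono') (simp add: ennreal_times_divide divide_right_mono_ennreal)
  also have "\<dots> = R * power_series_deriv f R"
    using power_series_deriv_SUP[of f R] assms(1) by (simp add: R_def F_def)
  also have "\<dots> < \<infinity>"
    using R' assms(2) by (simp add: R_def ennreal_mult_less_top)
  finally show ?thesis
    using C R by (auto simp: R_def same_radius less_top[symmetric] ennreal_mult_eq_top_iff)
qed

end

text \<open>Only the position of \<open>\<Phi>\<close> has to be compared by other means than the growth of \<open>A\<close>.\<close>

lemma vj_type_eq:
  assumes af: "renewal_pair a f" and bg: "renewal_pair b g"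
    and ab: "\<And>z. z ^ L * power_series a z \<le> power_series b z"
    and ba: "\<And>z. z ^ L' * power_series b z \<le> power_series a z"
    and fg: "0 < convergence_radius a \<Longrightarrow> convergence_radius a < convergence_radius f \<Longrightarrow>
               convergence_radius a < convergence_radius g"
    and gf: "0 < convergence_radius b \<Longrightarrow> convergence_radius b < convergence_radius g \<Longrightarrow>
               convergence_radius b < convergence_radius f"
  shows "vj_type a f c \<longleftrightarrow> vj_type b g c"
proof -
  let ?R = "convergence_radius a"
  have R: "convergence_radius b = ?R"
    by (intro antisym radius_le_if_dominated[OF ab] radius_le_if_dominated[OF ba])
  have rec: "power_series f ?R = 1 \<longleftrightarrow> power_series g ?R = 1"
    using dominated_recurrent[OF af bg ab R[symmetric]] dominated_recurrent[OF bg af ba R]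
    by (auto simp: R)
  have tr: "power_series f ?R < 1 \<longleftrightarrow> power_series g ?R < 1"
    using rec renewal_le_1_at_radius[OF af] renewal_le_1_at_radius[OF bg] by (auto simp: R less_le)
  have der: "power_series_deriv f ?R < \<infinity> \<longleftrightarrow> power_series_deriv g ?R < \<infinity>"
    if "power_series f ?R = 1"
    using that dominated_deriv_finite[OF af bg ab R[symmetric]] dominated_deriv_finite[OF bg af ba R] rec
    by (auto simp: R)
  have strong: "?R < convergence_radius f \<longleftrightarrow> ?R < convergence_radius g"
    if "power_series f ?R = 1"
  proof -
    have "?R \<noteq> 0"
      using renewal_radius_nonzero[OF af that] .
    then show ?thesis
      using fg gf by (auto simp: R zero_less_iff_neq_zero)
  qed
  have "?R \<le> convergence_radius f" "?R \<le> convergence_radius g"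
    using renewal_radius_le_Phi[OF af] renewal_radius_le_Phi[OF bg] by (auto simp: R)
  then have weak: "?R = convergence_radius f \<longleftrightarrow> ?R = convergence_radius g"
    if "power_series f ?R = 1"
    using strong[OF that] by (auto simp: le_less)
  show ?thesis
    unfolding vj_type_def Let_def R
    using rec tr der strong weak by (cases c) (auto simp: less_top[symmetric])
qed

section \<open>Counting orbit segments by return times\<close>

text \<open>Tonelli for counting measures on arbitrary types. The points of the interval form an
  uncountable type.\<close>

lemma nn_integral_count_space_swap:
  fixes f :: "'a \<Rightarrow> 'b \<Rightarrow> ennreal"
  shows "(\<integral>\<^sup>+x. \<integral>\<^sup>+y. f x y \<partial>count_space UNIV \<partial>count_space UNIV)
       = (\<integral>\<^sup>+y. \<integral>\<^sup>+x. f x y \<partial>count_space UNIV \<partial>count_space UNIV)"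
  using nn_integral_fst_count_space[of "\<lambda>(x, y). f x y"] nn_integral_snd_count_space[of "\<lambda>(x, y). f x y"]
  by simp

lemma nn_integral_count_space_inj_le:
  fixes f :: "'a \<Rightarrow> ennreal" and g :: "'b \<Rightarrow> ennreal"
  assumes "inj_on v A" "\<And>x. x \<in> A \<Longrightarrow> f x \<le> g (v x)" "\<And>x. x \<notin> A \<Longrightarrow> f x = 0"
  shows "(\<integral>\<^sup>+x. f x \<partial>count_space UNIV) \<le> (\<integral>\<^sup>+x. g x \<partial>count_space UNIV)"
proof -
  have "(\<integral>\<^sup>+x. f x \<partial>count_space UNIV) = (\<integral>\<^sup>+x. f x \<partial>count_space A)"
    using assms(3) by (intro nn_integral_count_space_eq) auto
  also have "\<dots> \<le> (\<integral>\<^sup>+x. g (v x) \<partial>count_space A)"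
    using assms(2) by (intro nn_integral_mono) simp
  also have "\<dots> = (\<integral>\<^sup>+x. g x \<partial>count_space (v ` A))"
    using assms(1) by (intro nn_integral_bij_count_space inj_on_imp_bij_betw)
  also have "\<dots> = (\<integral>\<^sup>+x. g x * indicator (v ` A) x \<partial>count_space UNIV)"
    by (rule nn_integral_count_space_indicator) simp
  also have "\<dots> \<le> (\<integral>\<^sup>+x. g x \<partial>count_space UNIV)"
    by (intro nn_integral_mono) (simp add: indicator_def)
  finally show ?thesis .
qed

section \<open>Visits to a set and \<open>s\<close>-fold returns\<close>

definition visits :: "('a \<Rightarrow> 'a) \<Rightarrow> 'a set \<Rightarrow> 'a \<Rightarrow> nat \<Rightarrow> nat" where
  "visits T U x n = card {k. k < n \<and> (T ^^ k) x \<in> U}"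

lemma visits_0 [simp]: "visits T U x 0 = 0"
  by (simp add: visits_def)

lemma visits_Suc: "visits T U x (Suc n) = visits T U x n + of_bool ((T ^^ n) x \<in> U)"
proof -
  have "{k. k < Suc n \<and> (T ^^ k) x \<in> U}
      = {k. k < n \<and> (T ^^ k) x \<in> U} \<union> (if (T ^^ n) x \<in> U then {n} else {})"
    by (auto simp: less_Suc_eq)
  then show ?thesis
    by (auto simp: visits_def card_Un_disjoint)
qed

lemma funpow_add_apply: "(T ^^ (m + n)) x = (T ^^ n) ((T ^^ m) x)"
  by (subst add.commute) (simp add: funpow_add)

lemma visits_add: "visits T U x (m + n) = visits T U x m + visits T U ((T ^^ m) x) n"
proof (induction n)
  case (Suc n)
  then show ?case
    by (simp add: visits_Suc funpow_add_apply)
qed simp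

text \<open>As \<open>visits\<close> counts time 0 but not time \<open>n\<close>, the numbers add up
  under concatenation; \<open>s = 0\<close> leaves only segments of length 0, and
  \<open>s = 1\<close> gives the first returns.\<close>

definition returns :: "('a \<Rightarrow> 'a) \<Rightarrow> 'a set \<Rightarrow> nat \<Rightarrow> 'a \<Rightarrow> nat \<Rightarrow> bool" where
  "returns T U s x n \<longleftrightarrow> x \<in> U \<and> (T ^^ n) x \<in> U \<and> visits T U x n = s"

lemma returns_0_iff: "returns T U 0 x n \<longleftrightarrow> x \<in> U \<and> n = 0"
proof -
  have "visits T U x n \<noteq> 0" if "x \<in> U" "0 < n"
  proof -
    have "0 \<in> {k. k < n \<and> (T ^^ k) x \<in> U}"
      using that by simp
    then have "card {k. k < n \<and> (T ^^ k) x \<in> U} > 0"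
      by (subst card_gt_0_iff) auto
    then show ?thesis
      unfolding visits_def by linarith
  qed
  then show ?thesis
    by (cases "n = 0") (auto simp: returns_def)
qed

lemma returns_1_iff:
  "returns T U 1 x n \<longleftrightarrow> 0 < n \<and> x \<in> U \<and> (T ^^ n) x \<in> U \<and> (\<forall>k. 0 < k \<and> k < n \<longrightarrow> (T ^^ k) x \<notin> U)"
proof -
  have "visits T U x n = 1 \<longleftrightarrow> 0 < n \<and> (\<forall>k. 0 < k \<and> k < n \<longrightarrow> (T ^^ k) x \<notin> U)" if "x \<in> U"
  proof (cases "n = 0")
    case False
    then have *: "{k. k < n \<and> (T ^^ k) x \<in> U} = insert 0 {k. 0 < k \<and> k < n \<and> (T ^^ k) x \<in> U}"
      using that by (auto intro: gr0I)
    have "visits T U x n = Suc (card {k. 0 < k \<and> k < n \<and> (T ^^ k) x \<in> U})"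
      unfolding visits_def * by (subst card_insert_disjoint) auto
    with False show ?thesis
      by (auto simp: card_eq_0_iff)
  qed simp
  then show ?thesis
    by (auto simp: returns_def)
qed

lemma returns_add:
  assumes "returns T U i x k" "returns T U j ((T ^^ k) x) m"
  shows "returns T U (i + j) x (k + m)"
  using assms by (auto simp: returns_def visits_add funpow_add_apply)

lemma returns_split:
  assumes "returns T U (i + j) x n"
  obtains k m where "n = k + m" "returns T U i x k" "returns T U j ((T ^^ k) x) m"
proof -
  have "\<exists>k\<le>n. (T ^^ k) x \<in> U \<and> visits T U x k = i"
    if "(T ^^ n) x \<in> U" "visits T U x n = i + j" for j
    using that
  proof (induction j arbitrary: n)
    case (Suc j)
    \<comment> \<open>The number of visits grows by at most one per step, so the time before
      \<open>k\<close> is a visit that is preceded by exactly \<open>i + j\<close> visits.\<close>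
    define k where "k = (LEAST k. i + j < visits T U x k)"
    have k: "i + j < visits T U x k"
      unfolding k_def by (rule LeastI[of _ n]) (use Suc.prems in simp)
    have "k \<le> n"
      unfolding k_def by (rule Least_le) (use Suc.prems in simp)
    obtain l where l: "k = Suc l"
      using k by (cases k) auto
    have "\<not> i + j < visits T U x l"
      using not_less_Least[of l "\<lambda>k. i + j < visits T U x k"] l by (simp add: k_def)
    with k l have "visits T U x l = i + j" "(T ^^ l) x \<in> U"
      by (cases "(T ^^ l) x \<in> U"; simp add: visits_Suc)+
    with Suc.IH[of l] obtain k' where "k' \<le> l" "(T ^^ k') x \<in> U" "visits T U x k' = i"
      by blast
    with \<open>k \<le> n\<close> l show ?case
      by (intro exI[of _ k']) simp
  qed auto
  then obtain k where k: "k \<le> n" "(T ^^ k) x \<in> U" "visits T U x k = i"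
    using assms unfolding returns_def by blast
  then obtain m where m: "n = k + m"
    using le_Suc_ex by blast
  have "(T ^^ n) x = (T ^^ m) ((T ^^ k) x)"
    by (simp add: m funpow_add_apply)
  with k m assms show thesis
    by (intro that[of k m]) (auto simp: returns_def visits_add)
qed

text \<open>Two different split times would be joined by a segment of positive length without
  visits, although its starting point lies in \<open>U\<close>.\<close>

lemma returns_split_unique:
  assumes "returns T U i x k" "returns T U i x k'"
  shows "k = k'"
proof -
  have "\<not> k < k'" if "returns T U i x k" "returns T U i x k'" for k k'
  proof
    assume "k < k'"
    then obtain m where "k' = k + Suc m"
      using less_imp_Suc_add by fastforce
    then have "returns T U 0 ((T ^^ k) x) (Suc m)"
      using that by (simp only: returns_def visits_add funpow_add_apply) simp
    then show False
      by (simp add: returns_0_iff)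
  qed
  then show ?thesis
    using assms by (meson linorder_neqE_nat)
qed

lemma returns_bij_betw:
  "bij_betw (\<lambda>(k, m). k + m) {(k, m). returns T U i x k \<and> returns T U j ((T ^^ k) x) m}
     {n. returns T U (i + j) x n}"
  unfolding bij_betw_def
proof
  show "inj_on (\<lambda>(k, m). k + m) {(k, m). returns T U i x k \<and> returns T U j ((T ^^ k) x) m}"
    by (auto simp: inj_on_def dest: returns_split_unique)
  show "(\<lambda>(k, m). k + m) ` {(k, m). returns T U i x k \<and> returns T U j ((T ^^ k) x) m}
      = {n. returns T U (i + j) x n}"
    by (auto intro: returns_add elim!: returns_split)
qed

text \<open>A pair \<open>(x, n)\<close> stands for the orbit segment of length \<open>n\<close> from \<open>x\<close>; \<open>E\<close> selects
  segments, and the weights \<open>w\<close> of interest are multiplicative under concatenation.\<close>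

definition orbit_gf ::
    "('a \<Rightarrow> 'a) \<Rightarrow> ('a \<Rightarrow> nat \<Rightarrow> ennreal) \<Rightarrow> ('a \<Rightarrow> nat \<Rightarrow> bool) \<Rightarrow> ennreal \<Rightarrow> 'a \<Rightarrow> ennreal" where
  "orbit_gf T w E z y = (\<integral>\<^sup>+x. \<integral>\<^sup>+n. w x n * z ^ n * of_bool (E x n \<and> (T ^^ n) x = y)
      \<partial>count_space UNIV \<partial>count_space UNIV)"

definition cocycle :: "('a \<Rightarrow> 'a) \<Rightarrow> ('a \<Rightarrow> nat \<Rightarrow> ennreal) \<Rightarrow> bool" where
  "cocycle T w \<longleftrightarrow> (\<forall>x m n. w x (m + n) = w x m * w ((T ^^ m) x) n)"

text \<open>Every \<open>(i + j)\<close>-fold return splits uniquely at its \<open>i\<close>-th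
  return. Grouping by the splitting point gives the generating function of the first parts as a
  factor that depends only on that point.\<close>

lemma orbit_gf_concat:
  assumes "cocycle T w"
  shows "orbit_gf T w (returns T U (i + j)) z y =
    (\<integral>\<^sup>+x. \<integral>\<^sup>+m. orbit_gf T w (returns T U i) z x *
       (w x m * z ^ m * of_bool (returns T U j x m \<and> (T ^^ m) x = y)) \<partial>count_space UNIV \<partial>count_space UNIV)"
proof -
  define P where "P x' m = w x' m * z ^ m * of_bool (returns T U j x' m \<and> (T ^^ m) x' = y)" for x' m
  define Q where "Q x k = w x k * z ^ k * of_bool (returns T U i x k)" for x k
  have inner: "(\<integral>\<^sup>+n. w x n * z ^ n * of_bool (returns T U (i + j) x n \<and> (T ^^ n) x = y) \<partial>count_space UNIV)
      = (\<integral>\<^sup>+k. \<integral>\<^sup>+m. Q x k * P ((T ^^ k) x) m \<partial>count_space UNIV \<partial>count_space UNIV)" for x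
  proof -
    let ?B = "{(k, m). returns T U i x k \<and> returns T U j ((T ^^ k) x) m}"
    define h where "h n = w x n * z ^ n * of_bool ((T ^^ n) x = y)" for n
    have "(\<integral>\<^sup>+n. w x n * z ^ n * of_bool (returns T U (i + j) x n \<and> (T ^^ n) x = y) \<partial>count_space UNIV)
        = (\<integral>\<^sup>+n. h n * indicator {n. returns T U (i + j) x n} n \<partial>count_space UNIV)"
      by (intro nn_integral_cong) (auto simp: h_def indicator_def)
    also have "\<dots> = (\<integral>\<^sup>+n. h n \<partial>count_space {n. returns T U (i + j) x n})"
      by (simp add: nn_integral_count_space_indicator)
    also have "\<dots> = (\<integral>\<^sup>+p. h (case p of (k, m) \<Rightarrow> k + m) \<partial>count_space ?B)"
      by (rule nn_integral_bij_count_space[OF returns_bij_betw, symmetric])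
    also have "\<dots> = (\<integral>\<^sup>+p. h (case p of (k, m) \<Rightarrow> k + m) * indicator ?B p \<partial>count_space UNIV)"
      by (simp add: nn_integral_count_space_indicator)
    also have "\<dots> = (\<integral>\<^sup>+p. (case p of (k, m) \<Rightarrow> Q x k * P ((T ^^ k) x) m) \<partial>count_space UNIV)"
    proof (intro nn_integral_cong)
      fix p :: "nat \<times> nat"
      obtain k m where p: "p = (k, m)" by (cases p)
      have "w x (k + m) = w x k * w ((T ^^ k) x) m"
        using assms by (simp add: cocycle_def)
      then show "h (case p of (k, m) \<Rightarrow> k + m) * indicator ?B p
          = (case p of (k, m) \<Rightarrow> Q x k * P ((T ^^ k) x) m)"
        by (simp add: p h_def P_def Q_def indicator_def power_add funpow_add_apply mult_ac split: if_splits; blast)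
    qed
    also have "\<dots> = (\<integral>\<^sup>+k. \<integral>\<^sup>+m. Q x k * P ((T ^^ k) x) m \<partial>count_space UNIV \<partial>count_space UNIV)"
      by (subst nn_integral_fst_count_space[symmetric]) simp
    finally show ?thesis .
  qed
  have "orbit_gf T w (returns T U (i + j)) z y
      = (\<integral>\<^sup>+x. \<integral>\<^sup>+k. \<integral>\<^sup>+m. Q x k * P ((T ^^ k) x) m \<partial>count_space UNIV \<partial>count_space UNIV \<partial>count_space UNIV)"
    by (simp add: orbit_gf_def inner)
  \<comment> \<open>The splitting point becomes a summation variable \<open>x'\<close> of its own,
    so that the sums over \<open>x\<close> and \<open>k\<close> can be carried out first.\<close>
  also have "\<dots> = (\<integral>\<^sup>+x. \<integral>\<^sup>+k. \<integral>\<^sup>+x'. (Q x k * of_bool ((T ^^ k) x = x')) * (\<integral>\<^sup>+m. P x' m \<partial>count_space UNIV)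
      \<partial>count_space UNIV \<partial>count_space UNIV \<partial>count_space UNIV)"
  proof (intro nn_integral_cong)
    fix x k
    have "(\<integral>\<^sup>+x'. (Q x k * of_bool ((T ^^ k) x = x')) * (\<integral>\<^sup>+m. P x' m \<partial>count_space UNIV) \<partial>count_space UNIV)
        = (\<integral>\<^sup>+x'. (Q x k * (\<integral>\<^sup>+m. P x' m \<partial>count_space UNIV)) * indicator {(T ^^ k) x} x' \<partial>count_space UNIV)"
      by (intro nn_integral_cong) (auto simp: indicator_def)
    also have "\<dots> = Q x k * (\<integral>\<^sup>+m. P ((T ^^ k) x) m \<partial>count_space UNIV)"
      by simp
    finally show "(\<integral>\<^sup>+m. Q x k * P ((T ^^ k) x) m \<partial>count_space UNIV)
        = (\<integral>\<^sup>+x'. (Q x k * of_bool ((T ^^ k) x = x')) * (\<integral>\<^sup>+m. P x' m \<partial>count_space UNIV) \<partial>count_space UNIV)"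
      by (simp add: nn_integral_cmult)
  qed
  also have "\<dots> = (\<integral>\<^sup>+x. \<integral>\<^sup>+x'. (\<integral>\<^sup>+k. Q x k * of_bool ((T ^^ k) x = x') \<partial>count_space UNIV) *
      (\<integral>\<^sup>+m. P x' m \<partial>count_space UNIV) \<partial>count_space UNIV \<partial>count_space UNIV)"
    unfolding nn_integral_multc[OF borel_measurable_count_space, symmetric]
    by (intro nn_integral_cong, rule nn_integral_count_space_swap)
  also have "\<dots> = (\<integral>\<^sup>+x'. (\<integral>\<^sup>+x. \<integral>\<^sup>+k. Q x k * of_bool ((T ^^ k) x = x') \<partial>count_space UNIV \<partial>count_space UNIV) *
      (\<integral>\<^sup>+m. P x' m \<partial>count_space UNIV) \<partial>count_space UNIV)"
    unfolding nn_integral_multc[OF borel_measurable_count_space, symmetric]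
    by (rule nn_integral_count_space_swap)
  also have "\<dots> = (\<integral>\<^sup>+x'. \<integral>\<^sup>+m. orbit_gf T w (returns T U i) z x' * P x' m \<partial>count_space UNIV \<partial>count_space UNIV)"
    by (simp add: orbit_gf_def Q_def nn_integral_cmult of_bool_conj mult.assoc)
  finally show ?thesis
    by (simp add: P_def)
qed

lemma orbit_gf_concat_eq:
  assumes "cocycle T w" "\<And>x. x \<in> U \<Longrightarrow> orbit_gf T w (returns T U i) z x = \<alpha>"
  shows "orbit_gf T w (returns T U (i + j)) z y = \<alpha> * orbit_gf T w (returns T U j) z y"
proof -
  have "orbit_gf T w (returns T U (i + j)) z y =
    (\<integral>\<^sup>+x. \<integral>\<^sup>+m. \<alpha> * (w x m * z ^ m * of_bool (returns T U j x m \<and> (T ^^ m) x = y)) \<partial>count_space UNIV \<partial>count_space UNIV)"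
    unfolding orbit_gf_concat[OF assms(1)]
    by (intro nn_integral_cong) (auto simp: assms(2) returns_def)
  then show ?thesis
    by (simp add: orbit_gf_def nn_integral_cmult)
qed

lemma orbit_gf_concat_le:
  assumes "cocycle T w" "\<And>x. x \<in> U \<Longrightarrow> orbit_gf T w (returns T U i) z x \<le> \<alpha>"
  shows "orbit_gf T w (returns T U (i + j)) z y \<le> \<alpha> * orbit_gf T w (returns T U j) z y"
proof -
  have "orbit_gf T w (returns T U (i + j)) z y \<le>
    (\<integral>\<^sup>+x. \<integral>\<^sup>+m. \<alpha> * (w x m * z ^ m * of_bool (returns T U j x m \<and> (T ^^ m) x = y)) \<partial>count_space UNIV \<partial>count_space UNIV)"
    unfolding orbit_gf_concat[OF assms(1)]
    by (intro nn_integral_mono) (auto simp: returns_def intro!: mult_right_mono assms(2))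
  then show ?thesis
    by (simp add: orbit_gf_def nn_integral_cmult)
qed

lemma orbit_gf_power_series:
  "orbit_gf T w E z y =
    power_series (\<lambda>n. \<integral>\<^sup>+x. w x n * of_bool (E x n \<and> (T ^^ n) x = y) \<partial>count_space UNIV) z"
proof -
  have "orbit_gf T w E z y = (\<integral>\<^sup>+n. \<integral>\<^sup>+x. w x n * of_bool (E x n \<and> (T ^^ n) x = y) * z ^ n
      \<partial>count_space UNIV \<partial>count_space UNIV)"
    unfolding orbit_gf_def by (subst nn_integral_count_space_swap) (simp add: mult_ac)
  then show ?thesis
    by (simp add: power_series_def nn_integral_multc nn_integral_count_space_nat)
qed

lemma nn_integral_of_bool:
  "(\<integral>\<^sup>+x. of_bool (P x) \<partial>count_space UNIV) = emeasure (count_space UNIV) {x. P x}"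
proof -
  have "(\<integral>\<^sup>+x. of_bool (P x) \<partial>count_space UNIV) = (\<integral>\<^sup>+x. indicator {x. P x} x \<partial>count_space UNIV)"
    by (intro nn_integral_cong) (simp add: indicator_def)
  then show ?thesis by simp
qed

section \<open>Return systems and their renewal equation\<close>

abbreviation ecard :: "'a set \<Rightarrow> ennreal" where
  "ecard \<equiv> emeasure (count_space UNIV)"

text \<open>The counts do not depend on the end point \<open>y\<close> in \<open>U\<close>, which
  makes the generating functions of repeated returns powers of one series. The assumption
  \<open>recurs\<close> yields the divergence of the series of \<open>a\<close> at 1.\<close>

locale return_system =
  fixes T :: "'a \<Rightarrow> 'a" and U :: "'a set" and a f :: "nat \<Rightarrow> ennreal"
  assumes nonempty: "U \<noteq> {}"
    and count_all: "\<And>n y. y \<in> U \<Longrightarrow> ecard {x \<in> U. (T ^^ n) x = y} = a n"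
    and count_first: "\<And>n y. y \<in> U \<Longrightarrow> ecard {x. returns T U 1 x n \<and> (T ^^ n) x = y} = f n"
    and recurs: "\<exists>n>0. U \<subseteq> (T ^^ n) ` U"
begin

lemma first_return_gf: "y \<in> U \<Longrightarrow> orbit_gf T (\<lambda>_ _. 1) (returns T U 1) z y = power_series f z"
  by (simp add: orbit_gf_power_series nn_integral_of_bool count_first del: One_nat_def)

lemma returns_gf:
  assumes "y \<in> U"
  shows "orbit_gf T (\<lambda>_ _. 1) (returns T U s) z y = power_series f z ^ s"
  using assms
proof (induction s arbitrary: y)
  case 0
  have "orbit_gf T (\<lambda>_ _. 1) (returns T U 0) z y
      = (\<integral>\<^sup>+x. \<integral>\<^sup>+n. (of_bool (x = y) * z ^ n) * indicator {0} n \<partial>count_space UNIV \<partial>count_space UNIV)"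
    unfolding orbit_gf_def using 0
    by (intro nn_integral_cong) (auto simp: returns_0_iff indicator_def)
  also have "\<dots> = 1"
    by (simp add: nn_integral_of_bool)
  finally show ?case by simp
next
  case (Suc s)
  then show ?case
    using orbit_gf_concat_eq[of T "\<lambda>_ _. 1" U 1 z "power_series f z" s y] first_return_gf
    by (simp add: cocycle_def)
qed

text \<open>A segment from \<open>U\<close> to \<open>U\<close> is an \<open>s\<close>-fold return
  for exactly one \<open>s\<close>, its number of visits.\<close>

lemma all_gf:
  assumes "y \<in> U"
  shows "power_series a z = (\<Sum>s. power_series f z ^ s)"
proof -
  have "power_series a z = orbit_gf T (\<lambda>_ _. 1) (\<lambda>x _. x \<in> U) z y"
    using assms by (simp add: orbit_gf_power_series nn_integral_of_bool count_all)
  also have "\<dots> = (\<integral>\<^sup>+x. \<integral>\<^sup>+n. (\<Sum>s. 1 * z ^ n * of_bool (returns T U s x n \<and> (T ^^ n) x = y))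
      \<partial>count_space UNIV \<partial>count_space UNIV)"
    unfolding orbit_gf_def
  proof (intro nn_integral_cong)
    fix x n
    have "(\<Sum>s. 1 * z ^ n * of_bool (returns T U s x n \<and> (T ^^ n) x = y))
        = 1 * z ^ n * of_bool (returns T U (visits T U x n) x n \<and> (T ^^ n) x = y)"
      by (subst suminf_finite[of "{visits T U x n}"]) (auto simp: returns_def)
    then show "1 * z ^ n * of_bool (x \<in> U \<and> (T ^^ n) x = y)
        = (\<Sum>s. 1 * z ^ n * of_bool (returns T U s x n \<and> (T ^^ n) x = y))"
      using assms by (auto simp: returns_def)
  qed
  also have "\<dots> = (\<Sum>s. orbit_gf T (\<lambda>_ _. 1) (returns T U s) z y)"
    by (simp add: orbit_gf_def nn_integral_suminf del: ennreal_suminf_cmult)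
  finally show ?thesis
    using assms by (simp add: returns_gf)
qed

lemma count_all_nonzero: "\<exists>n>0. \<forall>k. 1 \<le> a (k * n)"
proof -
  obtain n where n: "0 < n" "U \<subseteq> (T ^^ n) ` U"
    using recurs by blast
  obtain y where y: "y \<in> U"
    using nonempty by blast
  have "\<exists>x\<in>U. (T ^^ (k * n)) x = y" for k
    using y
  proof (induction k arbitrary: y)
    case (Suc k)
    then obtain x where "x \<in> U" "(T ^^ (k * n)) x = y" by blast
    moreover then obtain x' where "x' \<in> U" "(T ^^ n) x' = x" using n(2) by blast
    ultimately show ?case
      by (intro bexI[of _ x']) (simp_all add: funpow_add_apply)
  qed auto
  then have "1 \<le> ecard {x \<in> U. (T ^^ (k * n)) x = y}" for k
  proof -
    obtain x where "x \<in> U" "(T ^^ (k * n)) x = y"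
      using \<open>\<And>k. \<exists>x\<in>U. (T ^^ (k * n)) x = y\<close> by blast
    then have "ecard {x} \<le> ecard {x \<in> U. (T ^^ (k * n)) x = y}"
      by (intro emeasure_mono) auto
    then show ?thesis by simp
  qed
  with n(1) show ?thesis
    by (auto simp: count_all[OF y])
qed

lemma is_renewal_pair: "renewal_pair a f"
proof -
  obtain y where y: "y \<in> U"
    using nonempty by blast
  have "f 0 = 0"
    using count_first[OF y, of 0] by (simp add: returns_def)
  moreover have "power_series a 1 = \<infinity>"
  proof -
    obtain n where n: "0 < n" "\<And>k. 1 \<le> a (k * n)"
      using count_all_nonzero by blast
    \<comment> \<open>Infinitely many coefficients, those at multiples of \<open>n\<close>, are at
      least 1.\<close>
    have "(\<integral>\<^sup>+k. 1 \<partial>count_space (UNIV :: nat set)) \<le> (\<integral>\<^sup>+m. a m \<partial>count_space UNIV)"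
      using n by (intro nn_integral_count_space_inj_le[where v = "\<lambda>k. k * n" and A = UNIV]) (auto simp: inj_on_def)
    then show ?thesis
      by (simp add: power_series_def nn_integral_count_space_nat top_unique)
  qed
  ultimately show ?thesis
    using all_gf[OF y] by (simp add: renewal_pair_def)
qed

end

section \<open>Mutual domination of two return systems\<close>

lemma power_series_shift_le:
  assumes "\<And>n. c * a n \<le> b (n + L)"
  shows "c * z ^ L * power_series a z \<le> power_series b z"
proof -
  have "c * z ^ L * power_series a z = (\<Sum>n. c * a n * z ^ (n + L))"
    by (simp add: power_series_def power_add mult_ac flip: ennreal_suminf_cmult)
  also have "\<dots> \<le> (\<Sum>n. b (n + L) * z ^ (n + L))"
    by (intro suminf_le mult_right_mono assms) auto
  also have "\<dots> \<le> (\<Sum>n. b n * z ^ n)"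
    by (subst (2) suminf_offset[of _ L]) auto
  finally show ?thesis by (simp add: power_series_def)
qed

lemma ecard_inj_le:
  "inj_on v A \<Longrightarrow> v ` A \<subseteq> B \<Longrightarrow> ecard A \<le> ecard B"
  using nn_integral_count_space_inj_le[of v A "\<lambda>x. of_bool (x \<in> A)" "\<lambda>x. of_bool (x \<in> B)"]
  by (simp add: nn_integral_of_bool image_subset_iff)

locale return_systems = U: return_system T U a f + V: return_system T V b g
  for T :: "'a \<Rightarrow> 'a" and U V a b f g +
  assumes UV: "\<exists>k. V \<subseteq> (T ^^ k) ` U" and VU: "\<exists>k. U \<subseteq> (T ^^ k) ` V"
begin

text \<open>A segment from \<open>U\<close> to \<open>y\<close> is prolonged by a path of length
  \<open>k'\<close> from \<open>V\<close> before it and a path of length \<open>k\<close> to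
  \<open>V\<close> after it. The starting points \<open>v x\<close> are distinct because
  \<open>T ^^ k'\<close> maps them back to \<open>x\<close>.\<close>

lemma all_gf_dominated: "\<exists>L. \<forall>z. z ^ L * power_series a z \<le> power_series b z"
proof -
  obtain k k' where k: "V \<subseteq> (T ^^ k) ` U" and k': "U \<subseteq> (T ^^ k') ` V"
    using UV VU by blast
  obtain y y' where y: "y' \<in> V" "y \<in> U" "(T ^^ k) y = y'"
    using k V.nonempty by blast
  obtain v where v: "\<And>x. x \<in> U \<Longrightarrow> v x \<in> V \<and> (T ^^ k') (v x) = x"
    using k' by (metis image_iff subset_iff)
  have "a n \<le> b (n + (k' + k))" for n
  proof -
    have "(T ^^ (n + (k' + k))) x = (T ^^ k) ((T ^^ n) ((T ^^ k') x))" for x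
      by (metis add.assoc add.commute funpow_add_apply)
    then have "ecard {x \<in> U. (T ^^ n) x = y} \<le> ecard {x \<in> V. (T ^^ (n + (k' + k))) x = y'}"
      using v y by (intro ecard_inj_le[of v]) (auto intro!: inj_onI, metis)
    then show ?thesis
      using y by (simp only: U.count_all V.count_all)
  qed
  then show ?thesis
    using power_series_shift_le[of 1 a b "k' + k"] by auto
qed

end

text \<open>Convexity of powers replaces continuity of the generating function at \<open>r\<close>, uniformly in
  the end point.\<close>

lemma orbit_gf_convex:
  fixes r z t :: real
  assumes "0 \<le> r" "0 \<le> z" "0 \<le> t" "t \<le> 1"
  shows "orbit_gf T w E (ennreal ((1 - t) * r + t * z)) y
    \<le> ennreal (1 - t) * orbit_gf T w E (ennreal r) y + ennreal t * orbit_gf T w E (ennreal z) y"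
proof -
  have pow: "ennreal ((1 - t) * r + t * z) ^ n \<le> ennreal (1 - t) * ennreal r ^ n + ennreal t * ennreal z ^ n" for n
  proof -
    have "((1 - t) * r + t * z) ^ n \<le> (1 - t) * r ^ n + t * z ^ n"
      using assms convex_onD[OF convex_power_even, of n t r z] convex_onD[OF convex_power_odd, of n t r z]
      by (cases "even n") auto
    then show ?thesis
      using assms by (simp add: ennreal_power ennreal_leI flip: ennreal_mult ennreal_plus)
  qed
  let ?S = "\<lambda>z. \<Sum>n. (\<integral>\<^sup>+x. w x n * of_bool (E x n \<and> (T ^^ n) x = y) \<partial>count_space UNIV) * z ^ n"
  have "?S (ennreal ((1 - t) * r + t * z))
      \<le> (\<Sum>n. ennreal (1 - t) * ((\<integral>\<^sup>+x. w x n * of_bool (E x n \<and> (T ^^ n) x = y) \<partial>count_space UNIV) * ennreal r ^ n)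
          + ennreal t * ((\<integral>\<^sup>+x. w x n * of_bool (E x n \<and> (T ^^ n) x = y) \<partial>count_space UNIV) * ennreal z ^ n))"
    by (intro suminf_le order_trans[OF mult_left_mono[OF pow]]) (auto simp: algebra_simps)
  also have "\<dots> = ennreal (1 - t) * ?S (ennreal r) + ennreal t * ?S (ennreal z)"
    by (subst suminf_add[symmetric]) auto
  finally show ?thesis
    by (simp add: orbit_gf_power_series power_series_def)
qed

text \<open>The terms come in blocks of \<open>s\<close> equal ones, so the sum is at most
  \<open>s\<close> times a geometric series.\<close>

lemma suminf_div_power_finite:
  fixes h :: ennreal
  assumes "0 < s" "h < 1"
  shows "(\<Sum>n. h ^ (n div s)) < \<infinity>"
proof -
  have "(\<Sum>i<n. h ^ (i div s)) \<le> of_nat s * (\<Sum>m. h ^ m)" for n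
  proof -
    have "(\<Sum>i<n. h ^ (i div s)) \<le> (\<Sum>i<n * s. h ^ (i div s))"
      using assms(1) by (intro sum_mono2) auto
    also have "\<dots> = (\<Sum>m<n. \<Sum>i=m * s..<m * s + s. h ^ (i div s))"
      by (rule sum.nat_group[symmetric])
    also have "\<dots> = (\<Sum>m<n. \<Sum>i=m * s..<m * s + s. h ^ m)"
    proof (intro sum.cong refl)
      fix m i assume "i \<in> {m * s..<m * s + s}"
      then have "i div s = m"
        by (intro div_nat_eqI) (auto simp: mult.commute)
      then show "h ^ (i div s) = h ^ m" by simp
    qed
    also have "\<dots> = of_nat s * (\<Sum>m<n. h ^ m)"
      by (simp add: sum_distrib_left)
    also have "\<dots> \<le> of_nat s * (\<Sum>m. h ^ m)"
      by (intro mult_left_mono sum_le_suminf) auto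
    finally show ?thesis .
  qed
  then have "(\<Sum>n. h ^ (n div s)) \<le> of_nat s * (\<Sum>m. h ^ m)"
    unfolding suminf_eq_SUP by (intro SUP_least)
  also have "\<dots> < \<infinity>"
    using assms(2) by (simp add: ennreal_mult_less_top geometric_ennreal_finite_iff[unfolded infinity_ennreal_def] of_nat_less_top)
  finally show ?thesis .
qed

section \<open>Penalized visits and convergence beyond the radius\<close>

context return_system
begin

text \<open>Halving the weight at each visit to \<open>C\<close> pushes the generating function of the
  \<open>s\<close>-fold returns strictly below \<open>1\<close> at \<open>R\<close>, hence also slightly beyond \<open>R\<close> if \<open>F\<close>
  converges there.\<close>

definition visit_penalty :: "'a set \<Rightarrow> 'a \<Rightarrow> nat \<Rightarrow> ennreal" where
  "visit_penalty C x n = (1 / 2) ^ visits T C x n"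

lemma visit_penalty_cocycle: "cocycle T (visit_penalty C)"
  by (simp add: cocycle_def visit_penalty_def visits_add power_add)

lemma visit_penalty_le_1: "visit_penalty C x n \<le> 1"
  unfolding visit_penalty_def by (intro power_le_one) (auto simp: divide_le_posI_ennreal)

lemma visit_penalty_gf_le: "y \<in> U \<Longrightarrow> orbit_gf T (visit_penalty C) (returns T U s) z y \<le> power_series f z ^ s"
  unfolding returns_gf[symmetric] orbit_gf_def
  by (intro nn_integral_mono mult_right_mono) (auto simp: visit_penalty_le_1)

text \<open>One of the \<open>s\<close>-fold returns to \<open>y\<close> starts in \<open>C\<close>,
  where time 0 is already a penalized visit. Its weight is at most 1/2, so at least
  \<open>z ^ p / 2\<close> is lost, uniformly in \<open>y\<close>.\<close>

lemma visit_penalty_gf_gain: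
  assumes "0 < p" "C \<subseteq> U" "(T ^^ p) ` C = U" "\<And>x. x \<in> C \<Longrightarrow> visits T U x p = s" "y \<in> U"
  shows "orbit_gf T (visit_penalty C) (returns T U s) z y + z ^ p / 2 \<le> power_series f z ^ s"
proof -
  obtain x0 where x0: "x0 \<in> C" "(T ^^ p) x0 = y"
    using assms by blast
  then have ret: "returns T U s x0 p"
    using assms by (auto simp: returns_def)
  have "0 < visits T C x0 p"
    unfolding visits_def using x0 assms(1) by (subst card_gt_0_iff) (auto intro!: exI[of _ 0])
  then obtain k where k: "visits T C x0 p = Suc k"
    using gr0_implies_Suc by blast
  have half: "visit_penalty C x0 p + 1 / 2 \<le> 1"
  proof -
    have "visit_penalty C x0 p \<le> (1 / 2) * 1"
      unfolding visit_penalty_def k power_Suc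
      by (intro mult_left_mono power_le_one) (auto simp: divide_le_posI_ennreal)
    then have "visit_penalty C x0 p + 1 / 2 \<le> 1 / 2 + (1 / 2 :: ennreal)"
      by (intro add_right_mono) simp
    also have "\<dots> = 1"
      by (simp only: add_divide_distrib_ennreal[symmetric] one_add_one) simp
    finally show ?thesis .
  qed
  \<comment> \<open>Half the contribution of the single segment \<open>(x0, p)\<close>: it can be
    added to the penalized integrand without exceeding the original one.\<close>
  define B where "B x n = of_bool (x = x0 \<and> n = p) * (z ^ p / 2)" for x n
  have B: "(\<integral>\<^sup>+x. \<integral>\<^sup>+n. B x n \<partial>count_space UNIV \<partial>count_space UNIV) = z ^ p / 2"
    by (simp add: B_def nn_integral_multc of_bool_conj nn_integral_cmult nn_integral_of_bool)
  have "orbit_gf T (visit_penalty C) (returns T U s) z y + z ^ p / 2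
    = (\<integral>\<^sup>+x. \<integral>\<^sup>+n. (visit_penalty C x n * z ^ n * of_bool (returns T U s x n \<and> (T ^^ n) x = y) + B x n)
      \<partial>count_space UNIV \<partial>count_space UNIV)"
    by (simp add: orbit_gf_def nn_integral_add B)
  also have "\<dots> \<le> orbit_gf T (\<lambda>_ _. 1) (returns T U s) z y"
    unfolding orbit_gf_def
  proof (intro nn_integral_mono)
    fix x n
    show "visit_penalty C x n * z ^ n * of_bool (returns T U s x n \<and> (T ^^ n) x = y) + B x n
        \<le> 1 * z ^ n * of_bool (returns T U s x n \<and> (T ^^ n) x = y)"
    proof (cases "x = x0 \<and> n = p")
      case True
      have "(visit_penalty C x0 p + 1 / 2) * z ^ p \<le> 1 * z ^ p"
        by (intro mult_right_mono half) auto
      then show ?thesis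
        using True ret x0 by (simp add: B_def distrib_left divide_ennreal_def mult.commute)
    next
      case False
      then show ?thesis
        using mult_right_mono[OF visit_penalty_le_1[of C x n], of "z ^ n"] by (auto simp: B_def)
    qed
  qed
  also have "\<dots> = power_series f z ^ s"
    by (rule returns_gf[OF assms(5)])
  finally show ?thesis .
qed

text \<open>Each block of \<open>s\<close> returns contributes a factor \<open>h\<close>, and the
  penalty on the last \<open>r\<close> returns is dropped.\<close>

lemma visit_penalty_gf_power_le:
  assumes "\<And>x. x \<in> U \<Longrightarrow> orbit_gf T (visit_penalty C) (returns T U s) z x \<le> h" "y \<in> U"
  shows "orbit_gf T (visit_penalty C) (returns T U (m * s + r)) z y \<le> h ^ m * power_series f z ^ r"
proof (induction m)
  case 0
  then show ?case using visit_penalty_gf_le[OF assms(2)] by simp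
next
  case (Suc m)
  have "orbit_gf T (visit_penalty C) (returns T U (s + (m * s + r))) z y
      \<le> h * orbit_gf T (visit_penalty C) (returns T U (m * s + r)) z y"
    by (rule orbit_gf_concat_le[OF visit_penalty_cocycle assms(1)])
  also have "\<dots> \<le> h * (h ^ m * power_series f z ^ r)"
    by (intro mult_left_mono Suc) auto
  finally show ?case by (simp add: mult_ac add_ac)
qed

lemma visit_penalty_gf_decompose:
  "orbit_gf T (visit_penalty C) (\<lambda>x n. x \<in> U \<and> (T ^^ n) x \<in> U) z y
    = (\<Sum>s. orbit_gf T (visit_penalty C) (returns T U s) z y)"
proof -
  have "orbit_gf T (visit_penalty C) (\<lambda>x n. x \<in> U \<and> (T ^^ n) x \<in> U) z y
      = (\<integral>\<^sup>+x. \<integral>\<^sup>+n. (\<Sum>s. visit_penalty C x n * z ^ n * of_bool (returns T U s x n \<and> (T ^^ n) x = y))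
      \<partial>count_space UNIV \<partial>count_space UNIV)"
    unfolding orbit_gf_def
  proof (intro nn_integral_cong)
    fix x n
    have "(\<Sum>s. visit_penalty C x n * z ^ n * of_bool (returns T U s x n \<and> (T ^^ n) x = y))
        = visit_penalty C x n * z ^ n * of_bool (returns T U (visits T U x n) x n \<and> (T ^^ n) x = y)"
      by (subst suminf_finite[of "{visits T U x n}"]) (auto simp: returns_def)
    then show "visit_penalty C x n * z ^ n * of_bool ((x \<in> U \<and> (T ^^ n) x \<in> U) \<and> (T ^^ n) x = y)
        = (\<Sum>s. visit_penalty C x n * z ^ n * of_bool (returns T U s x n \<and> (T ^^ n) x = y))"
      by (auto simp: returns_def)
  qed
  also have "\<dots> = (\<Sum>s. orbit_gf T (visit_penalty C) (returns T U s) z y)"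
    by (simp add: orbit_gf_def nn_integral_suminf del: ennreal_suminf_cmult)
  finally show ?thesis .
qed

text \<open>At the radius a block of \<open>s\<close> returns has total weight at most
  \<open>1 - \<delta>\<close>. Convexity between \<open>r\<close> and a point \<open>x1\<close>
  where \<open>f\<close> still converges keeps it below 1 at some \<open>x > r\<close>, and the
  blocks then sum like a geometric series.\<close>

lemma visit_penalty_gf_finite_beyond_radius:
  assumes C: "0 < p" "C \<subseteq> U" "(T ^^ p) ` C = U" "\<And>x. x \<in> C \<Longrightarrow> visits T U x p = s"
    and R: "0 < convergence_radius a" "convergence_radius a < convergence_radius f"
  shows "\<exists>z>convergence_radius a. \<forall>y\<in>U.
    orbit_gf T (visit_penalty C) (\<lambda>x n. x \<in> U \<and> (T ^^ n) x \<in> U) z y < \<infinity>"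
proof -
  obtain r where r: "convergence_radius a = ennreal r" "0 < r" "r \<le> 1"
    using R(1) renewal_radius_le_1[OF is_renewal_pair]
    by (cases "convergence_radius a") (auto simp: top_unique)
  obtain z1 where "convergence_radius a < z1" "z1 < convergence_radius f"
    using R(2) dense by blast
  then obtain x1 where x1: "z1 = ennreal x1" "r < x1"
    using r by (cases z1) (auto simp: ennreal_less_iff)
  have F1: "power_series f z1 < \<infinity>"
    by (rule power_series_finite_if_lt_radius) fact
  then obtain M where M: "power_series f z1 ^ s = ennreal M" "0 \<le> M"
    by (cases "power_series f z1 ^ s") (auto simp: power_eq_top_ennreal)
  obtain x0 where "x0 \<in> C"
    using C(3) nonempty by blast
  then have "0 \<in> {k. k < p \<and> (T ^^ k) x0 \<in> U}"
    using C(1,2) by auto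
  then have "0 < s"
    unfolding C(4)[OF \<open>x0 \<in> C\<close>, symmetric] visits_def by (subst card_gt_0_iff) auto
  \<comment> \<open>The loss at \<open>r\<close> that the return starting in \<open>C\<close>
    guarantees.\<close>
  define \<delta> where "\<delta> = r ^ p / 2"
  have \<delta>: "0 < \<delta>" "\<delta> \<le> 1 / 2"
    using r by (auto simp: \<delta>_def power_le_one)
  \<comment> \<open>Chosen so that \<open>t * M\<close> uses up at most half of the gain
    \<open>\<delta>\<close>; the summand 1 keeps the denominator positive when
    \<open>M = 0\<close>.\<close>
  define t where "t = \<delta> / (2 * (M + 1))"
  have t: "0 < t" "t \<le> 1" "t * M \<le> \<delta> / 2"
    using \<delta> M(2) by (auto simp: t_def field_simps intro: order_trans[of _ 1])
  define x where "x = (1 - t) * r + t * x1"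
  have x: "r < x" "x \<le> x1"
  proof -
    have "x - r = t * (x1 - r)" "x1 - x = (1 - t) * (x1 - r)"
      by (auto simp: x_def algebra_simps)
    with t x1 show "r < x" "x \<le> x1"
      by (smt (verit) mult_pos_pos mult_nonneg_nonneg)+
  qed
  define h where "h = ennreal ((1 - t) * (1 - \<delta>) + t * M)"
  have "(1 - t) * (1 - \<delta>) + t * M \<le> (1 - \<delta>) + \<delta> / 2"
    using t \<delta> by (intro add_mono mult_left_le_one_le) auto
  then have h: "h < 1"
    unfolding h_def ennreal_less_one_iff using \<delta> by simp
  have gf_le: "orbit_gf T (visit_penalty C) (returns T U s) (ennreal x) y \<le> h" if "y \<in> U" for y
  proof -
    have "orbit_gf T (visit_penalty C) (returns T U s) (ennreal r) y + ennreal \<delta>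
        = orbit_gf T (visit_penalty C) (returns T U s) (ennreal r) y + ennreal r ^ p / 2"
      using r by (simp add: \<delta>_def ennreal_power divide_ennreal[symmetric])
    also have "\<dots> \<le> power_series f (ennreal r) ^ s"
      by (rule visit_penalty_gf_gain[OF C that])
    also have "\<dots> \<le> 1"
      using renewal_le_1_at_radius[OF is_renewal_pair] by (intro power_le_one) (auto simp: r)
    finally have "orbit_gf T (visit_penalty C) (returns T U s) (ennreal r) y \<le> 1 - ennreal \<delta>"
      by (simp add: ennreal_le_minus_iff add.commute)
    also have "\<dots> = ennreal (1 - \<delta>)"
      using \<delta> by (simp add: ennreal_minus flip: ennreal_1)
    finally have gr: "orbit_gf T (visit_penalty C) (returns T U s) (ennreal r) y \<le> ennreal (1 - \<delta>)" .
    have gx: "orbit_gf T (visit_penalty C) (returns T U s) (ennreal x1) y \<le> ennreal M"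
      using visit_penalty_gf_le[OF that, of C s z1] unfolding M(1) by (simp add: x1(1))
    have "orbit_gf T (visit_penalty C) (returns T U s) (ennreal x) y
        \<le> ennreal (1 - t) * orbit_gf T (visit_penalty C) (returns T U s) (ennreal r) y
          + ennreal t * orbit_gf T (visit_penalty C) (returns T U s) (ennreal x1) y"
      unfolding x_def using r x1 t by (intro orbit_gf_convex) auto
    also have "\<dots> \<le> ennreal (1 - t) * ennreal (1 - \<delta>) + ennreal t * ennreal M"
      by (intro add_mono mult_left_mono gr gx) auto
    also have "\<dots> = h"
      using t \<delta> M(2) by (simp add: h_def flip: ennreal_mult ennreal_plus)
    finally show ?thesis .
  qed
  \<comment> \<open>A common bound for the fewer than \<open>s\<close> returns left over after
    division into blocks; adding 1 makes the powers increase with the exponent.\<close>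
  define K where "K = (1 + power_series f (ennreal x)) ^ s"
  have "power_series f (ennreal x) \<le> power_series f z1"
    unfolding x1 using x by (intro power_series_mono ennreal_leI)
  then have "power_series f (ennreal x) < \<infinity>"
    using F1 by (rule le_less_trans)
  then have K: "K < \<infinity>"
    by (simp add: K_def power_less_top_ennreal)
  have "orbit_gf T (visit_penalty C) (\<lambda>x n. x \<in> U \<and> (T ^^ n) x \<in> U) (ennreal x) y < \<infinity>" if "y \<in> U" for y
  proof -
    have le: "orbit_gf T (visit_penalty C) (returns T U n) (ennreal x) y \<le> K * h ^ (n div s)" for n
    proof -
      have "orbit_gf T (visit_penalty C) (returns T U (n div s * s + n mod s)) (ennreal x) y
          \<le> h ^ (n div s) * power_series f (ennreal x) ^ (n mod s)"
        using gf_le that by (rule visit_penalty_gf_power_le)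
      also have "\<dots> \<le> h ^ (n div s) * (1 + power_series f (ennreal x)) ^ (n mod s)"
        by (intro mult_left_mono power_mono) auto
      also have "\<dots> \<le> h ^ (n div s) * K"
        unfolding K_def using \<open>0 < s\<close> by (intro mult_left_mono power_increasing) (auto intro: less_imp_le)
      finally show ?thesis by (simp add: mult.commute)
    qed
    have "orbit_gf T (visit_penalty C) (\<lambda>x n. x \<in> U \<and> (T ^^ n) x \<in> U) (ennreal x) y
        \<le> (\<Sum>n. K * h ^ (n div s))"
      unfolding visit_penalty_gf_decompose by (intro suminf_le le) auto
    also have "\<dots> < \<infinity>"
      using K suminf_div_power_finite[OF \<open>0 < s\<close> h] by (simp add: ennreal_mult_less_top)
    finally show ?thesis .
  qed
  moreover have "convergence_radius a < ennreal x"
    using r x by (simp add: ennreal_less_iff)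
  ultimately show ?thesis by blast
qed

end

section \<open>Transfer of strong recurrence\<close>

lemma visits_le_card_mono:
  assumes "{k. k < n \<and> (T ^^ k) x \<in> U} \<subseteq> A" "finite A"
  shows "visits T U x n \<le> card A"
  unfolding visits_def using assms by (intro card_mono)

context return_systems
begin

text \<open>A first return to \<open>V\<close> is prolonged on both sides to a segment from
  \<open>U\<close> to \<open>U\<close>. A visit to \<open>C\<close> forces a visit to
  \<open>V\<close> after \<open>q\<close> steps, so visits to \<open>C\<close> can occur only near
  the two ends. Their number is bounded independently of \<open>n\<close>, and the penalty is at
  least \<open>c\<close>.\<close>

lemma visit_penalty_first_return_le:
  assumes "C \<subseteq> U" "(T ^^ q) ` C \<subseteq> V"
  shows "\<exists>c L. \<exists>y\<in>U. c \<noteq> 0 \<and> (\<forall>n. c * g n \<le>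
    (\<integral>\<^sup>+x. U.visit_penalty C x (n + L) * of_bool ((x \<in> U \<and> (T ^^ (n + L)) x \<in> U) \<and> (T ^^ (n + L)) x = y)
      \<partial>count_space UNIV))"
proof -
  obtain k k' where k: "V \<subseteq> (T ^^ k) ` U" and k': "U \<subseteq> (T ^^ k') ` V"
    using UV VU by blast
  obtain y y' where y: "y' \<in> V" "y \<in> U" "(T ^^ k') y' = y"
    using k' U.nonempty by blast
  obtain u where u: "\<And>x. x \<in> V \<Longrightarrow> u x \<in> U \<and> (T ^^ k) (u x) = x"
    using k by (metis image_iff subset_iff)
  \<comment> \<open>The exponent counts the admissible times: \<open>k + 1\<close> at the beginning
    and at most \<open>q + k'\<close> at the end.\<close>
  define c :: ennreal where "c = (1 / 2) ^ (k + 1 + (q + k'))"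
  have "c * g n \<le>
    (\<integral>\<^sup>+x. U.visit_penalty C x (n + (k + k')) * of_bool ((x \<in> U \<and> (T ^^ (n + (k + k'))) x \<in> U)
      \<and> (T ^^ (n + (k + k'))) x = y) \<partial>count_space UNIV)" for n
  proof -
    define A where "A = {x. returns T V 1 x n \<and> (T ^^ n) x = y'}"
    have T_eq: "(T ^^ (n + (k + k'))) x = (T ^^ k') ((T ^^ n) ((T ^^ k) x))" for x
      by (metis add.assoc add.commute funpow_add_apply)
    have weight: "c \<le> U.visit_penalty C (u x) (n + (k + k'))" if "x \<in> A" for x
    proof -
      have xV: "x \<in> V" and first: "\<And>i. 0 < i \<Longrightarrow> i < n \<Longrightarrow> (T ^^ i) x \<notin> V"
        using that by (auto simp: A_def returns_1_iff simp del: One_nat_def)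
      have "{i. i < n + (k + k') \<and> (T ^^ i) (u x) \<in> C} \<subseteq> {..k} \<union> {n + k - q..<n + k + k'}"
      proof
        fix i assume i: "i \<in> {i. i < n + (k + k') \<and> (T ^^ i) (u x) \<in> C}"
        show "i \<in> {..k} \<union> {n + k - q..<n + k + k'}"
        proof (rule ccontr)
          assume "i \<notin> {..k} \<union> {n + k - q..<n + k + k'}"
          with i have *: "k < i" "i + q < n + k" by auto
          \<comment> \<open>The time \<open>i + q\<close> lies strictly between the start
            \<open>k\<close> and the end \<open>n + k\<close> of the first return.\<close>
          then have "(T ^^ (i + q - k)) x \<notin> V"
            by (intro first) auto
          moreover have "(T ^^ (i + q)) (u x) \<in> V"
            using i assms(2) by (auto simp: funpow_add_apply)
          moreover have "(T ^^ (k + (i + q - k))) (u x) = (T ^^ (i + q - k)) x"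
            using u[OF xV] by (simp only: funpow_add_apply)
          ultimately show False
            using * by simp
        qed
      qed
      then have "visits T C (u x) (n + (k + k')) \<le> card ({..k} \<union> {n + k - q..<n + k + k'})"
        by (intro visits_le_card_mono) auto
      also have "\<dots> \<le> card {..k} + card {n + k - q..<n + k + k'}"
        by (rule card_Un_le)
      also have "\<dots> \<le> k + 1 + (q + k')"
        by simp
      finally show ?thesis
        unfolding c_def U.visit_penalty_def by (intro power_decreasing) (auto simp: divide_le_posI_ennreal)
    qed
    have "c * g n = (\<integral>\<^sup>+x. c * of_bool (x \<in> A) \<partial>count_space UNIV)"
      using V.count_first[OF y(1)] by (simp add: nn_integral_cmult nn_integral_of_bool A_def)
    also have "\<dots> \<le> (\<integral>\<^sup>+x. U.visit_penalty C x (n + (k + k')) * of_bool ((x \<in> U \<and> (T ^^ (n + (k + k'))) x \<in> U)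
      \<and> (T ^^ (n + (k + k'))) x = y) \<partial>count_space UNIV)"
    proof (rule nn_integral_count_space_inj_le[where v = u and A = A])
      have AV: "x \<in> V" "(T ^^ n) x = y'" if "x \<in> A" for x
        using that by (auto simp: A_def returns_def)
      show "inj_on u A"
        by (rule inj_onI) (metis AV(1) u)
      show "c * of_bool (x \<in> A) \<le> U.visit_penalty C (u x) (n + (k + k')) * of_bool
         ((u x \<in> U \<and> (T ^^ (n + (k + k'))) (u x) \<in> U) \<and> (T ^^ (n + (k + k'))) (u x) = y)" if "x \<in> A" for x
        using that weight[OF that] AV[OF that] u[OF AV(1)[OF that]] y by (simp add: T_eq)
    qed simp
    finally show ?thesis .
  qed
  moreover have "c \<noteq> 0"
    by (simp add: c_def divide_ennreal_def)
  ultimately show ?thesis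
    using y(2) by blast
qed

text \<open>At some point beyond the radius the penalized series of \<open>U\<close> is finite, and
  it dominates a nonzero multiple of the first return series of \<open>V\<close>.\<close>

lemma strong_recurrence_transfer:
  assumes "0 < p" "C \<subseteq> U" "(T ^^ p) ` C = U" "\<And>x. x \<in> C \<Longrightarrow> visits T U x p = s"
    and "(T ^^ q) ` C \<subseteq> V"
    and "0 < convergence_radius a" "convergence_radius a < convergence_radius f"
  shows "convergence_radius a < convergence_radius g"
proof -
  obtain z where z: "convergence_radius a < z"
    and fin: "\<And>y. y \<in> U \<Longrightarrow> orbit_gf T (U.visit_penalty C) (\<lambda>x n. x \<in> U \<and> (T ^^ n) x \<in> U) z y < \<infinity>"
    using U.visit_penalty_gf_finite_beyond_radius[OF assms(1-4,6,7)] by blast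
  obtain c L y where y: "y \<in> U" "c \<noteq> 0" and c: "\<And>n. c * g n \<le>
    (\<integral>\<^sup>+x. U.visit_penalty C x (n + L) * of_bool ((x \<in> U \<and> (T ^^ (n + L)) x \<in> U) \<and> (T ^^ (n + L)) x = y)
      \<partial>count_space UNIV)"
    using visit_penalty_first_return_le[OF assms(2,5)] by blast
  have "c * z ^ L * power_series g z \<le> orbit_gf T (U.visit_penalty C) (\<lambda>x n. x \<in> U \<and> (T ^^ n) x \<in> U) z y"
    unfolding orbit_gf_power_series by (rule power_series_shift_le) (rule c)
  also have "\<dots> < \<infinity>"
    using y by (intro fin)
  finally have "power_series g z < \<infinity>"
    using y z by (auto simp: less_top[symmetric] ennreal_mult_eq_top_iff)
  then have "z \<le> convergence_radius g"
    by (rule radius_ge_if_power_series_finite)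
  with z show ?thesis by (rule less_le_trans)
qed

end

text \<open>\<open>C\<close> is a set of \<open>s\<close>-fold returns to \<open>U\<close> all of which pass through \<open>V\<close>, so first returns
  to \<open>V\<close> correspond to orbits of \<open>U\<close> that essentially avoid \<open>C\<close>.\<close>

definition full_return_through :: "('a \<Rightarrow> 'a) \<Rightarrow> 'a set \<Rightarrow> 'a set \<Rightarrow> bool" where
  "full_return_through T U V \<longleftrightarrow> (\<exists>C p q s. 0 < p \<and> C \<subseteq> U \<and> (T ^^ p) ` C = U \<and>
     (\<forall>x\<in>C. visits T U x p = s) \<and> (T ^^ q) ` C \<subseteq> V)"

theorem (in return_systems) vj_type_eq_return_systems:
  assumes "full_return_through T U V" "full_return_through T V U"
  shows "vj_type a f c \<longleftrightarrow> vj_type b g c"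
proof -
  interpret VU: return_systems T V U b a g f
    by unfold_locales (rule VU UV)+
  obtain L L' where "\<And>z. z ^ L * power_series a z \<le> power_series b z"
    "\<And>z. z ^ L' * power_series b z \<le> power_series a z"
    using all_gf_dominated VU.all_gf_dominated by blast
  moreover have "convergence_radius a < convergence_radius g"
    if "0 < convergence_radius a" "convergence_radius a < convergence_radius f"
    using assms(1) that unfolding full_return_through_def by (metis strong_recurrence_transfer)
  moreover have "convergence_radius b < convergence_radius f"
    if "0 < convergence_radius b" "convergence_radius b < convergence_radius g"
    using assms(2) that unfolding full_return_through_def by (metis VU.strong_recurrence_transfer)
  ultimately show ?thesis
    using vj_type_eq[OF U.is_renewal_pair V.is_renewal_pair] by blast
qed

section \<open>Laps of a map without plateaus\<close>

text \<open>Passing to \<open>- g\<close> reduces decreasing laps to increasing ones.\<close>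

lemma monotone_map_on_uminus: "monotone_map_on k (\<lambda>x. - g x) \<longleftrightarrow> monotone_map_on k g"
  by (auto simp: monotone_map_on_def monotone_on_def)

lemma max_monotone_interval_uminus:
  "max_monotone_interval (\<lambda>x. - g x) i i' \<longleftrightarrow> max_monotone_interval g i i'"
  by (simp add: max_monotone_interval_def monotone_map_on_uminus)

lemma is_interval_Union_common:
  fixes x :: real
  assumes "\<And>k. k \<in> K \<Longrightarrow> is_interval k \<and> x \<in> k"
  shows "is_interval (\<Union>K)"
proof -
  have "connected (\<Union>K)"
    using assms by (intro connected_Union) (auto simp: is_interval_connected_1)
  then show ?thesis by (simp add: is_interval_connected_1)
qed

lemma mono_on_Union_common:
  fixes g :: "real \<Rightarrow> real"
  assumes "\<And>k. k \<in> K \<Longrightarrow> is_interval k \<and> x \<in> k \<and> mono_on k g"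
  shows "mono_on (\<Union>K) g"
proof (rule mono_onI)
  fix u v assume "u \<in> \<Union>K" "v \<in> \<Union>K" "u \<le> v"
  then obtain k l where k: "k \<in> K" "u \<in> k" and l: "l \<in> K" "v \<in> l" by blast
  have x: "x \<in> k" "x \<in> l" and mono: "mono_on k g" "mono_on l g"
    and int: "is_interval k" "is_interval l"
    using assms k l by auto
  consider "v \<le> x" | "x \<le> u" | "u \<le> x" "x \<le> v" by linarith
  then show "g u \<le> g v"
  proof cases
    case 1
    then have "v \<in> k" using int k x \<open>u \<le> v\<close> unfolding is_interval_1 by blast
    then show ?thesis using mono k \<open>u \<le> v\<close> by (auto dest: mono_onD)
  next
    case 2
    then have "u \<in> l" using int l x \<open>u \<le> v\<close> unfolding is_interval_1 by blast
    then show ?thesis using mono l \<open>u \<le> v\<close> by (auto dest: mono_onD)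
  next
    case 3
    then show ?thesis using mono k l x by (meson mono_onD order_trans)
  qed
qed

text \<open>Monotonicity is meant in the weak sense, so a plateau could belong to an increasing and
  to a decreasing lap at once. Injectivity on monotone pieces excludes such overlaps.\<close>

definition no_plateau :: "real set \<Rightarrow> (real \<Rightarrow> real) \<Rightarrow> bool" where
  "no_plateau i g \<longleftrightarrow> (\<forall>k. is_interval k \<and> k \<subseteq> i \<and> monotone_map_on k g \<longrightarrow> inj_on g k)"

lemma no_plateau_uminus: "no_plateau i (\<lambda>x. - g x) \<longleftrightarrow> no_plateau i g"
  by (simp add: no_plateau_def monotone_map_on_uminus inj_on_def)

lemma no_plateau_antimono_mono:
  assumes "no_plateau i g" "is_interval k" "k \<subseteq> i" "antimono_on k g" "x \<in> k" "y \<in> k"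
    and "mono_on l g" "x \<in> l" "y \<in> l"
  shows "x = y"
proof -
  have "inj_on g k"
    using assms by (auto simp: no_plateau_def monotone_map_on_def)
  moreover have "g x = g y"
    using assms by (cases x y rule: linorder_cases) (force simp: monotone_on_def)+
  ultimately show ?thesis
    using assms by (auto dest: inj_onD)
qed

text \<open>The lap is the union of all increasing intervals through \<open>x\<close>. The second
  point \<open>y\<close> forces every monotone interval that contains this union to be increasing,
  hence to be part of it.\<close>

lemma ex_max_monotone_interval_mono:
  assumes np: "no_plateau i g" and d: "is_interval d" "d \<subseteq> i" "mono_on d g" "x \<in> d" "y \<in> d" "x \<noteq> y"
  shows "\<exists>i'. max_monotone_interval g i i' \<and> x \<in> i'"
proof -
  define K where "K = {k. is_interval k \<and> k \<subseteq> i \<and> x \<in> k \<and> mono_on k g}"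
  have int: "is_interval (\<Union>K)" and mono: "mono_on (\<Union>K) g"
    by (intro is_interval_Union_common[where x = x] mono_on_Union_common[where x = x]; simp add: K_def)+
  have "d \<in> K" using d by (simp add: K_def)
  have "k = \<Union>K" if k: "is_interval k" "k \<subseteq> i" "monotone_map_on k g" "\<Union>K \<subseteq> k" for k
  proof -
    have xy: "x \<in> k" "y \<in> k" using \<open>d \<in> K\<close> d k by auto
    have "mono_on k g"
      using k no_plateau_antimono_mono[OF np k(1,2) _ xy d(3,4,5)] d(6)
      by (auto simp: monotone_map_on_def)
    then have "k \<in> K" using k xy by (simp add: K_def)
    with k show ?thesis by auto
  qed
  moreover have "\<Union>K \<subseteq> i" by (auto simp: K_def)
  ultimately have "max_monotone_interval g i (\<Union>K)"
    using int mono by (simp add: max_monotone_interval_def monotone_map_on_def)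
  then show ?thesis
    using \<open>d \<in> K\<close> d by auto
qed

lemma ex_max_monotone_interval:
  assumes np: "no_plateau i g" and x: "x \<in> i"
  shows "\<exists>i'. max_monotone_interval g i i' \<and> x \<in> i'"
proof (cases "\<exists>d y. is_interval d \<and> d \<subseteq> i \<and> monotone_map_on d g \<and> x \<in> d \<and> y \<in> d \<and> x \<noteq> y")
  case True
  then obtain d y where d: "is_interval d" "d \<subseteq> i" "monotone_map_on d g" "x \<in> d" "y \<in> d" "x \<noteq> y"
    by blast
  show ?thesis
  proof (cases "mono_on d g")
    case True
    with ex_max_monotone_interval_mono[OF np d(1,2) _ d(4-6)] show ?thesis by blast
  next
    case False
    then have "mono_on d (\<lambda>x. - g x)"
      using d(3) by (auto simp: monotone_map_on_def monotone_on_def)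
    with ex_max_monotone_interval_mono[of i "\<lambda>x. - g x" d x y] np d show ?thesis
      by (simp add: no_plateau_uminus max_monotone_interval_uminus)
  qed
next
  \<comment> \<open>Here no monotone interval contains \<open>x\<close> together with another point,
    so the degenerate interval \<open>{x}\<close> is maximal.\<close>
  case False
  have "max_monotone_interval g i {x}"
    unfolding max_monotone_interval_def
  proof (intro conjI allI impI)
    fix k assume "is_interval k \<and> k \<subseteq> i \<and> monotone_map_on k g \<and> {x} \<subseteq> k"
    with False show "k = {x}" by auto
  qed (use x in \<open>auto simp: monotone_map_on_def monotone_on_def is_interval_1\<close>)
  then show ?thesis by blast
qed

text \<open>Two common points force the same direction of monotonicity. The union is then monotone,
  and maximality identifies it with both intervals.\<close>

lemma max_monotone_intervals_eq_mono:
  assumes np: "no_plateau i g" and k: "max_monotone_interval g i k" "max_monotone_interval g i l"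
    and xy: "x \<in> k" "x \<in> l" "y \<in> k" "y \<in> l" "x \<noteq> y" and mono: "mono_on k g"
  shows "k = l"
proof -
  have "mono_on l g"
    using k no_plateau_antimono_mono[OF np _ _ _ xy(2,4) mono xy(1,3)] xy(5)
    by (auto simp: max_monotone_interval_def monotone_map_on_def)
  then have "is_interval (\<Union>{k, l})" "mono_on (\<Union>{k, l}) g"
    using k xy mono
    by (intro is_interval_Union_common[where x = x] mono_on_Union_common[where x = x];
        auto simp: max_monotone_interval_def)+
  then have "is_interval (k \<union> l)" "monotone_map_on (k \<union> l) g" "k \<union> l \<subseteq> i"
    using k by (auto simp: max_monotone_interval_def monotone_map_on_def)
  with k have "k \<union> l = k" "k \<union> l = l"
    unfolding max_monotone_interval_def by (meson Un_upper1 Un_upper2)+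
  then show ?thesis by simp
qed

lemma max_monotone_intervals_disjoint:
  assumes np: "no_plateau i g" and k: "max_monotone_interval g i k" "max_monotone_interval g i l"
    and "k \<noteq> l"
  shows "interior k \<inter> interior l = {}"
proof (rule ccontr)
  assume "interior k \<inter> interior l \<noteq> {}"
  then obtain x where x: "x \<in> interior k \<inter> interior l" by blast
  then obtain e where e: "e > 0" "ball x e \<subseteq> interior k \<inter> interior l"
    by (metis open_Int open_contains_ball open_interior)
  moreover have "x + e / 2 \<in> ball x e" using e(1) by (simp add: dist_real_def)
  ultimately have xy: "x \<in> k" "x \<in> l" "x + e / 2 \<in> k" "x + e / 2 \<in> l" "x \<noteq> x + e / 2"
    using x interior_subset by (blast, blast, blast, blast, simp)
  have "k = l"
  proof (cases "mono_on k g")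
    case True
    with max_monotone_intervals_eq_mono[OF np k xy] show ?thesis by blast
  next
    case False
    then have "mono_on k (\<lambda>x. - g x)"
      using k(1) by (auto simp: max_monotone_interval_def monotone_map_on_def monotone_on_def)
    with max_monotone_intervals_eq_mono[of i "\<lambda>x. - g x" k l, OF _ _ _ xy] np k show ?thesis
      by (simp add: no_plateau_uminus max_monotone_interval_uminus)
  qed
  with \<open>k \<noteq> l\<close> show False ..
qed

lemma is_interval_greaterThanLessThan:
  fixes u v :: real
  assumes "is_interval c" "u \<in> c" "v \<in> c"
  shows "{u<..<v} \<subseteq> c"
proof
  fix z assume "z \<in> {u<..<v}"
  then have "u \<le> z \<and> z \<le> v" by simp
  with assms show "z \<in> c" unfolding is_interval_1 by blast
qed

lemma monotone_interior_point:
  fixes g :: "real \<Rightarrow> real"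
  assumes "is_interval c" "monotone_map_on c g" "x \<in> c" "u \<in> c" "v \<in> c" "g u < g x" "g x < g v"
  shows "x \<in> interior c"
proof -
  have "u < x \<and> x < v \<or> v < x \<and> x < u"
    using assms(2) unfolding monotone_map_on_def
  proof
    assume "mono_on c g"
    then show ?thesis
      using assms by (metis mono_onD not_le less_le_not_le)
  next
    assume "antimono_on c g"
    then show ?thesis
      using assms unfolding monotone_on_def by (metis not_le)
  qed
  then show ?thesis
    using is_interval_greaterThanLessThan[OF assms(1,4,5)] is_interval_greaterThanLessThan[OF assms(1,5,4)]
    by (metis greaterThanLessThan_iff interiorI open_greaterThanLessThan)
qed

lemma is_interval_monotone_preimage:
  fixes g :: "real \<Rightarrow> real"
  assumes "is_interval c" "monotone_map_on c g" "is_interval D"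
  shows "is_interval {x \<in> c. g x \<in> D}"
  unfolding is_interval_1
proof (intro ballI allI impI)
  fix a b x assume ab: "a \<in> {x \<in> c. g x \<in> D}" "b \<in> {x \<in> c. g x \<in> D}" and x: "a \<le> x \<and> x \<le> b"
  then have "x \<in> c" using assms(1) unfolding is_interval_1 by blast
  with ab x assms(2) have "g a \<le> g x \<and> g x \<le> g b \<or> g b \<le> g x \<and> g x \<le> g a"
    by (auto simp: monotone_map_on_def monotone_on_def)
  with \<open>x \<in> c\<close> ab assms(3) show "x \<in> {x \<in> c. g x \<in> D}"
    unfolding is_interval_1 by blast
qed

section \<open>Mixing interval maps\<close>

locale mixing_interval_map =
  fixes T :: "real \<Rightarrow> real"
  assumes continuous: "continuous_on {0..1} T"
    and self_map: "T ` {0..1} \<subseteq> {0..1}"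
    and mixing: "topologically_mixing_on {0..1} T"
begin

lemma iterate_mem: "x \<in> {0..1} \<Longrightarrow> (T ^^ n) x \<in> {0..1}"
  by (induction n) (use self_map in \<open>auto simp: image_subset_iff\<close>)

lemma iterate_continuous: "continuous_on {0..1} (T ^^ n)"
proof (induction n)
  case (Suc n)
  have "(T ^^ n) ` {0..1} \<subseteq> {0..1}"
    using iterate_mem by blast
  with Suc continuous have "continuous_on {0..1} (T \<circ> (T ^^ n))"
    by (intro continuous_on_compose) (auto intro: continuous_on_subset)
  then show ?case by simp
qed (simp add: continuous_on_id)

lemma eventually_hits:
  assumes "0 \<le> a" "a < b" "b \<le> 1" "0 \<le> c" "c < d" "d \<le> (1::real)"
  shows "\<exists>N. \<forall>n\<ge>N. \<exists>x\<in>{a<..<b}. (T ^^ n) x \<in> {c<..<d}"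
proof -
  have op: "openin (top_of_set {0..1}) {a<..<b}" if "0 \<le> a" "b \<le> 1" for a b :: real
    using that unfolding openin_open by (intro exI[of _ "{a<..<b}"]) auto
  have "{a<..<b} \<noteq> {}" "{c<..<d} \<noteq> {}"
    using assms by auto
  then have "\<exists>n. \<forall>m\<ge>n. (T ^^ m) ` {a<..<b} \<inter> {c<..<d} \<noteq> {}"
    using mixing op assms unfolding topologically_mixing_on_def by blast
  then show ?thesis by blast
qed

text \<open>At all large times the connected image meets \<open>{0<..<c}\<close> and
  \<open>{d<..<1}\<close> by mixing, so it contains everything in between.\<close>

lemma eventually_covers:
  assumes "0 \<le> a" "a < b" "b \<le> 1" "0 < c" "c \<le> d" "d < 1"
  shows "\<exists>N. \<forall>n\<ge>N. {c..d} \<subseteq> (T ^^ n) ` {a<..<b}"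
proof -
  obtain N where N: "\<And>n. n \<ge> N \<Longrightarrow> \<exists>x\<in>{a<..<b}. (T ^^ n) x \<in> {0<..<c}"
    using eventually_hits[of a b 0 c] assms by auto
  obtain N' where N': "\<And>n. n \<ge> N' \<Longrightarrow> \<exists>x\<in>{a<..<b}. (T ^^ n) x \<in> {d<..<1}"
    using eventually_hits[of a b d 1] assms by auto
  have "{c..d} \<subseteq> (T ^^ n) ` {a<..<b}" if n: "n \<ge> max N N'" for n
  proof -
    have "connected ((T ^^ n) ` {a<..<b})"
      using assms by (intro connected_continuous_image continuous_on_subset[OF iterate_continuous]) auto
    moreover obtain x where "x \<in> {a<..<b}" "(T ^^ n) x < c"
      using N[of n] n by auto
    moreover obtain x' where "x' \<in> {a<..<b}" "d < (T ^^ n) x'"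
      using N'[of n] n by auto
    ultimately have "{(T ^^ n) x..(T ^^ n) x'} \<subseteq> (T ^^ n) ` {a<..<b}"
      by (intro connected_contains_Icc) auto
    with \<open>(T ^^ n) x < c\<close> \<open>d < (T ^^ n) x'\<close> show ?thesis by auto
  qed
  then show ?thesis by blast
qed

text \<open>The images of an interval of constancy would be single points from the first step on,
  but they eventually cover \<open>{1/3..2/3}\<close>.\<close>

lemma not_constant:
  assumes "0 \<le> a" "a < b" "b \<le> 1" "\<And>x. x \<in> {a<..<b} \<Longrightarrow> T x = t"
  shows False
proof -
  obtain N where N: "\<And>n. n \<ge> N \<Longrightarrow> {1/3..2/3} \<subseteq> (T ^^ n) ` {a<..<b}"
    using eventually_covers[of a b "1/3" "2/3"] assms by auto
  have "(T ^^ Suc N) x = (T ^^ N) t" if "x \<in> {a<..<b}" for x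
    using assms(4)[OF that] by (simp add: funpow_swap1)
  then have "(T ^^ Suc N) ` {a<..<b} \<subseteq> {(T ^^ N) t}"
    by blast
  moreover have "{1/3..2/3} \<subseteq> (T ^^ Suc N) ` {a<..<b}"
    by (rule N) simp
  moreover have "(1/3::real) \<in> {1/3..2/3}" "(2/3::real) \<in> {1/3..2/3}"
    by auto
  ultimately have "(1/3::real) = (T ^^ N) t" "(2/3::real) = (T ^^ N) t"
    by blast+
  then show False by linarith
qed

lemma no_plateau_unit:
  assumes "i \<subseteq> {0..1}"
  shows "no_plateau i T"
  unfolding no_plateau_def
proof (intro allI impI)
  fix k assume k: "is_interval k \<and> k \<subseteq> i \<and> monotone_map_on k T"
  have False if xy: "x \<in> k" "y \<in> k" "T x = T y" "x < y" for x y
  proof (rule not_constant)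
    have sub: "{x..y} \<subseteq> k"
      using k xy unfolding is_interval_1 by (meson atLeastAtMost_iff subsetI)
    show "0 \<le> x" "x < y" "y \<le> 1"
      using k xy assms by auto
    fix z assume "z \<in> {x<..<y}"
    with sub have z: "z \<in> k" "x \<le> z" "z \<le> y" by auto
    with k xy have "T x \<le> T z \<and> T z \<le> T y \<or> T y \<le> T z \<and> T z \<le> T x"
      by (auto simp: monotone_map_on_def monotone_on_def)
    with xy show "T z = T x" by auto
  qed
  then show "inj_on T k"
    by (intro inj_onI) (metis linorder_less_linear)
qed

end

section \<open>Markov partitions\<close>

lemma markov_partition_with_elem:
  assumes "markov_partition_with mon T P" "i \<in> P"
  shows "\<exists>a b. 0 \<le> a \<and> a < b \<and> b \<le> 1 \<and> i = {a..b}" and "mon i T"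
proof -
  have "\<forall>i\<in>P. \<exists>a b. 0 \<le> a \<and> a < b \<and> b \<le> 1 \<and> i = {a..b}" "\<forall>i\<in>P. mon i T"
    using assms(1) unfolding markov_partition_with_def by - (elim conjE, assumption)+
  with assms(2) show "\<exists>a b. 0 \<le> a \<and> a < b \<and> b \<le> 1 \<and> i = {a..b}" "mon i T"
    by simp_all
qed

lemma markov_partition_with_mono:
  assumes "markov_partition_with mon T P" "\<And>i. i \<in> P \<Longrightarrow> mon i T \<Longrightarrow> mon' i T"
  shows "markov_partition_with mon' T P"
proof -
  have "\<forall>i\<in>P. mon' i T"
    using assms markov_partition_with_elem(2) by blast
  with assms(1) show ?thesis
    unfolding markov_partition_with_def by - (elim conjE, intro conjI; assumption)
qed

text \<open>The trivial division \<open>{i}\<close> witnesses piecewise monotonicity, so it suffices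
  to treat slack partitions.\<close>

lemma classical_imp_slack:
  assumes "classical_markov_partition T P"
  shows "slack_markov_partition T P"
proof -
  have P: "markov_partition_with monotone_map_on T P"
    using assms by (simp add: classical_markov_partition_def)
  have "piecewise_monotone_on i T" if "i \<in> P" "monotone_map_on i T" for i
  proof -
    have "\<exists>a b. 0 \<le> a \<and> a < b \<and> b \<le> 1 \<and> i = {a..b}"
      using P that(1) by (rule markov_partition_with_elem)
    then obtain a b where "a < b" "i = {a..b}" by blast
    then have "{i} division_of i"
      using division_of_self[of a b] by (simp add: cbox_interval)
    with that(2) show ?thesis
      unfolding piecewise_monotone_on_def by (intro exI[of _ "{i}"]) simp
  qed
  then show ?thesis
    unfolding slack_markov_partition_def using markov_partition_with_mono[OF P] by blast
qed

text \<open>Connects the sums in the matrix definitions with the integrals used for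
  counting.\<close>

lemma nn_integral_infsum:
  fixes h :: "'a \<Rightarrow> ennreal"
  assumes "countable I"
  shows "(\<Sum>\<^sub>\<infinity>x\<in>I. h x) = (\<integral>\<^sup>+x. h x \<partial>count_space I)"
proof (cases "finite I")
  case True
  then show ?thesis by (simp add: nn_integral_count_space_finite)
next
  case False
  have bij: "bij_betw (from_nat_into I) UNIV I"
    using assms False by (rule bij_betw_from_nat_into)
  have "(\<Sum>\<^sub>\<infinity>x\<in>I. h x) = (\<Sum>\<^sub>\<infinity>n. h (from_nat_into I n))"
    by (rule infsum_reindex_bij_betw[OF bij, symmetric])
  also have "\<dots> = (\<Sum>n. h (from_nat_into I n))"
    by (intro sums_unique has_sum_imp_sums has_sum_infsum nonneg_summable_on_complete) auto
  also have "\<dots> = (\<integral>\<^sup>+n. h (from_nat_into I n) \<partial>count_space UNIV)"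
    by (rule nn_integral_count_space_nat[symmetric])
  also have "\<dots> = (\<integral>\<^sup>+x. h x \<partial>count_space I)"
    by (rule nn_integral_bij_count_space[OF bij])
  finally show ?thesis .
qed

lemma ecard_vimage_uniform:
  assumes "\<And>z. z \<in> S \<Longrightarrow> ecard {x \<in> A. g x = z} = m"
  shows "ecard {x \<in> A. g x \<in> S} = m * ecard S"
proof -
  have "ecard {x \<in> A. g x \<in> S}
      = (\<integral>\<^sup>+x. \<integral>\<^sup>+z. of_bool (x \<in> A \<and> z \<in> S) * indicator {g x} z \<partial>count_space UNIV \<partial>count_space UNIV)"
    by (simp add: nn_integral_of_bool)
  also have "\<dots> = (\<integral>\<^sup>+z. \<integral>\<^sup>+x. of_bool (z \<in> S) * of_bool (x \<in> A \<and> g x = z) \<partial>count_space UNIV \<partial>count_space UNIV)"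
    by (subst nn_integral_count_space_swap) (auto intro!: nn_integral_cong simp: indicator_def)
  also have "\<dots> = (\<integral>\<^sup>+z. m * of_bool (z \<in> S) \<partial>count_space UNIV)"
    by (intro nn_integral_cong) (auto simp: nn_integral_cmult nn_integral_of_bool assms)
  also have "\<dots> = m * ecard S"
    by (simp add: nn_integral_cmult nn_integral_of_bool)
  finally show ?thesis .
qed

section \<open>Laps and backward orbits of interior points\<close>

locale markov_map = mixing_interval_map +
  fixes P :: "real set set"
  assumes slack: "slack_markov_partition T P"
begin

lemma markov_conditions:
  "countable P"
  "\<forall>i\<in>P. \<exists>a b. 0 \<le> a \<and> a < b \<and> b \<le> 1 \<and> i = {a..b}"
  "\<forall>i\<in>P. \<forall>j\<in>P. i \<noteq> j \<longrightarrow> interior i \<inter> interior j = {}"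
  "countable ({0..1} - \<Union>P)"
  "\<forall>i\<in>P. piecewise_monotone_on i T"
  "\<forall>i\<in>P. \<forall>j\<in>P. \<forall>i'. max_monotone_interval T i i' \<and> T ` i' \<inter> interior j \<noteq> {} \<longrightarrow> j \<subseteq> T ` i'"
  using slack unfolding slack_markov_partition_def markov_partition_with_def
  by - (elim conjE, assumption)+

lemma P_interval:
  assumes "i \<in> P"
  obtains a b where "0 \<le> a" "a < b" "b \<le> 1" "i = {a..b}" "interior i = {a<..<b}"
proof -
  obtain a b where ab: "0 \<le> a" "a < b" "b \<le> 1" "i = {a..b}"
    using markov_conditions(2) assms by blast
  show thesis
    by (rule that[OF ab]) (simp add: ab(4) interior_atLeastAtMost_real)
qed

lemma P_subset_unit: "i \<in> P \<Longrightarrow> i \<subseteq> {0..1}"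
  by (erule P_interval) auto

lemma P_eq_if_interior: "i \<in> P \<Longrightarrow> j \<in> P \<Longrightarrow> x \<in> interior i \<Longrightarrow> x \<in> interior j \<Longrightarrow> i = j"
  using markov_conditions(3) by blast

lemma P_nonempty: "P \<noteq> {}"
proof
  assume "P = {}"
  with markov_conditions(4) show False
    using uncountable_closed_interval[of 0 "1::real"] by simp
qed

lemma lap_covers:
  assumes "i \<in> P" "j \<in> P" "max_monotone_interval T i i'" "x \<in> i'" "T x \<in> interior j"
  shows "j \<subseteq> T ` i'"
proof -
  have "T ` i' \<inter> interior j \<noteq> {}" using assms(4,5) by blast
  with assms(1-3) markov_conditions(6) show ?thesis by blast
qed

text \<open>Both end points of \<open>j\<close> are values of \<open>T\<close> on \<open>c\<close>,
  one on each side of \<open>T x\<close>; by monotonicity \<open>x\<close> lies strictly between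
  their preimages.\<close>

lemma interior_if_covers:
  assumes "is_interval c" "monotone_map_on c T" "x \<in> c" "j \<in> P" "j \<subseteq> T ` c" "T x \<in> interior j"
  shows "x \<in> interior c"
proof -
  obtain a b where ab: "a < b" "j = {a..b}" "interior j = {a<..<b}"
    using assms(4) by (rule P_interval)
  then have "a \<in> T ` c" "b \<in> T ` c" using assms(5) by auto
  then obtain u v where "u \<in> c" "v \<in> c" "T u = a" "T v = b" by blast
  then show ?thesis
    using monotone_interior_point[OF assms(1-3)] ab assms(6) by auto
qed

text \<open>The Markov condition applies to a lap through \<open>x\<close> because its image meets
  the interior of \<open>j\<close>; covering \<open>j\<close> in turn moves \<open>x\<close> into
  the interior of the lap.\<close>

lemma lap_at:
  assumes "i \<in> P" "j \<in> P" "x \<in> i" "T x \<in> interior j"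
  obtains i' where "max_monotone_interval T i i'" "x \<in> interior i'" "j \<subseteq> T ` i'" "inj_on T i'"
proof -
  have np: "no_plateau i T"
    using assms(1) by (intro no_plateau_unit P_subset_unit)
  obtain i' where i': "max_monotone_interval T i i'" "x \<in> i'"
    using ex_max_monotone_interval[OF np assms(3)] by blast
  then have m: "is_interval i'" "monotone_map_on i' T" "i' \<subseteq> i"
    by (auto simp: max_monotone_interval_def)
  have "j \<subseteq> T ` i'"
    by (rule lap_covers[OF assms(1,2) i' assms(4)])
  moreover from this have "x \<in> interior i'"
    by (rule interior_if_covers[OF m(1,2) i'(2) assms(2) _ assms(4)])
  moreover have "inj_on T i'"
    using np m by (auto simp: no_plateau_def)
  ultimately show thesis
    using i' by (intro that)
qed

lemma preimage_interior_elem: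
  assumes "i \<in> P" "j \<in> P" "x \<in> i" "T x \<in> interior j"
  shows "x \<in> interior i"
proof -
  obtain i' where "max_monotone_interval T i i'" "x \<in> interior i'"
    using lap_at[OF assms] by blast
  then show ?thesis
    using interior_mono[of i' i] by (auto simp: max_monotone_interval_def)
qed

text \<open>Only countably many points are uncovered, so every interval meets an element. An element
  \<open>i\<close> close to \<open>x\<close> may be long, but an element between \<open>x\<close>
  and \<open>i\<close> is short.\<close>

lemma small_elem_near_uncovered:
  assumes "x \<in> {0..1}" "x \<notin> \<Union>P" "0 < e"
  obtains i where "i \<in> P" "i \<subseteq> ball x e"
proof -
  have covered: "\<exists>i\<in>P. \<exists>u\<in>i. u \<in> {c<..<d}" if "0 \<le> c" "c < d" "d \<le> 1" for c d
  proof (rule ccontr)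
    assume "\<not> ?thesis"
    then have "{c<..<d} \<subseteq> {0..1} - \<Union>P" using that by auto
    with markov_conditions(4) have "countable {c<..<d}"
      by (rule countable_subset[rotated])
    with that(2) show False using uncountable_open_interval by blast
  qed
  \<comment> \<open>A one-sided neighbourhood of \<open>x\<close>, to the right unless
    \<open>x = 1\<close>.\<close>
  obtain c d where cd: "0 \<le> c" "c < d" "d \<le> 1" "{c<..<d} \<subseteq> ball x e" "c = x \<or> d = x"
  proof (cases "x < 1")
    case True
    show thesis
      by (rule that[of x "min 1 (x + e)"]) (use True assms in \<open>auto simp: dist_real_def\<close>)
  next
    case False
    show thesis
      by (rule that[of "max 0 (x - e)" x]) (use False assms in \<open>auto simp: dist_real_def\<close>)
  qed
  obtain i u where i: "i \<in> P" "u \<in> i" "u \<in> {c<..<d}"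
    using covered[OF cd(1-3)] by blast
  obtain a b where ab: "a < b" "i = {a..b}" "interior i = {a<..<b}"
    using i(1) by (rule P_interval)
  have "x \<notin> {a..b}" using assms(2) i(1) ab(2) by blast
  then have side: "c = x \<and> x < a \<and> a \<le> u \<or> d = x \<and> b < x \<and> u \<le> b"
    using cd(5) i(2,3) ab by auto
  \<comment> \<open>The gap between \<open>x\<close> and \<open>i\<close>. An element
    \<open>k\<close> meeting it does not contain \<open>x\<close> and shares no interior point with
    \<open>i\<close>, so it cannot leave the closed gap.\<close>
  then obtain c' d' where cd': "0 \<le> c'" "c' < d'" "d' \<le> 1"
    "c' = x \<and> d' = a \<or> c' = b \<and> d' = x" "c \<le> c'" "d' \<le> d"
  proof
    assume "c = x \<and> x < a \<and> a \<le> u"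
    then show thesis using cd i(3) by (intro that[of x a]) auto
  next
    assume "d = x \<and> b < x \<and> u \<le> b"
    then show thesis using cd i(3) by (intro that[of b x]) auto
  qed
  obtain k v where k: "k \<in> P" "v \<in> k" "v \<in> {c'<..<d'}"
    using covered[OF cd'(1-3)] by blast
  obtain a' b' where ab': "a' < b'" "k = {a'..b'}" "interior k = {a'<..<b'}"
    using k(1) by (rule P_interval)
  have "x \<notin> {a'..b'}" using assms(2) k(1) ab'(2) by blast
  have "k \<noteq> i"
    using k ab cd'(4) side by auto
  have disj: "{a<..<b} \<inter> {a'<..<b'} = {}"
    using P_eq_if_interior[OF k(1) i(1)] \<open>k \<noteq> i\<close> ab(3) ab'(3) by blast
  have "k \<subseteq> {c<..<d} \<union> {c', d'}"
  proof -
    have "c' \<le> a' \<and> b' \<le> d'"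
      using cd'(4)
    proof
      assume *: "c' = x \<and> d' = a"
      then have "b' \<le> a"
      proof -
        have False if "a < b'"
        proof -
          have "(a + min b b') / 2 \<in> {a<..<b} \<inter> {a'<..<b'}"
            using that ab(1) * k ab' by (auto simp: min_def)
          with disj show False by blast
        qed
        then show ?thesis by force
      qed
      with * \<open>x \<notin> {a'..b'}\<close> k ab' show ?thesis by auto
    next
      assume *: "c' = b \<and> d' = x"
      then have "b \<le> a'"
      proof -
        have False if "a' < b"
        proof -
          have "(b + max a a') / 2 \<in> {a<..<b} \<inter> {a'<..<b'}"
            using that ab(1) * k ab' by (auto simp: max_def)
          with disj show False by blast
        qed
        then show ?thesis by force
      qed
      with * \<open>x \<notin> {a'..b'}\<close> k ab' show ?thesis by auto
    qed
    then show ?thesis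
      using ab' cd' by auto
  qed
  moreover have "c' \<in> ball x e" "d' \<in> ball x e"
    using cd'(2,4) side cd(4) i(3) assms(3) ab by (auto simp: dist_real_def subset_iff)
  ultimately have "k \<subseteq> ball x e"
    using cd(4) by auto
  with k(1) show thesis by (rule that)
qed

text \<open>If \<open>x\<close> were uncovered, continuity would give an element near
  \<open>x\<close> that is mapped into the interior of \<open>j\<close>. By the Markov condition its
  image also contains the end points of \<open>j\<close>.\<close>

lemma preimage_interior:
  assumes "x \<in> {0..1}" "j \<in> P" "T x \<in> interior j"
  shows "\<exists>i\<in>P. x \<in> interior i"
proof (cases "x \<in> \<Union>P")
  case True
  then show ?thesis
    using preimage_interior_elem assms(2,3) by blast
next
  case False
  obtain a b where ab: "a < b" "j = {a..b}" "interior j = {a<..<b}"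
    using assms(2) by (rule P_interval)
  define \<epsilon> where "\<epsilon> = min (T x - a) (b - T x)"
  have "0 < \<epsilon>" using assms(3) ab by (simp add: \<epsilon>_def)
  then obtain \<delta> where "0 < \<delta>" and \<delta>: "\<And>x'. x' \<in> {0..1} \<Longrightarrow> dist x' x < \<delta> \<Longrightarrow> dist (T x') (T x) < \<epsilon>"
    using continuous assms(1) unfolding continuous_on_iff by metis
  obtain k where k: "k \<in> P" "k \<subseteq> ball x \<delta>"
    using small_elem_near_uncovered[OF assms(1) False \<open>0 < \<delta>\<close>] by blast
  have Tk: "T z \<in> {a<..<b}" if "z \<in> k" for z
  proof -
    have "dist (T z) (T x) < \<epsilon>"
      using k(2) that P_subset_unit[OF k(1)] by (intro \<delta>) (auto simp: dist_commute)
    then show ?thesis by (auto simp: \<epsilon>_def dist_real_def)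
  qed
  obtain c d where "c < d" "k = {c..d}" using k(1) by (rule P_interval)
  then have "c \<in> k" "T c \<in> interior j" using Tk ab by auto
  then obtain k' where "max_monotone_interval T k k'" "j \<subseteq> T ` k'"
    using lap_at[OF k(1) assms(2)] by blast
  then have "k' \<subseteq> k" "a \<in> T ` k'"
    using ab by (auto simp: max_monotone_interval_def)
  then have "a \<in> T ` k" by blast
  with Tk show ?thesis by auto
qed

lemma iterate_preimage_interior:
  assumes "x \<in> {0..1}" "j \<in> P" "(T ^^ n) x \<in> interior j"
  shows "\<exists>i\<in>P. x \<in> interior i"
  using assms
proof (induction n arbitrary: x)
  case (Suc n)
  have "T x \<in> {0..1}" using Suc.prems(1) self_map by blast
  moreover have "(T ^^ n) (T x) \<in> interior j"
    using Suc.prems(3) by (simp add: funpow_swap1)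
  ultimately obtain i where "i \<in> P" "T x \<in> interior i"
    using Suc.IH Suc.prems(2) by blast
  then show ?case using Suc.prems(1) preimage_interior by blast
qed auto

section \<open>Transition matrix entries as cardinalities of fibers\<close>

lemma fiber_finite:
  assumes "i \<in> P"
  shows "finite {x \<in> i. T x = y}"
proof -
  obtain D where D: "D division_of i" and mon: "\<And>d. d \<in> D \<Longrightarrow> monotone_map_on d T"
    using bspec[OF markov_conditions(5) assms] unfolding piecewise_monotone_on_def by blast
  note d = division_ofD[OF D]
  have "finite {x \<in> d. T x = y}" if "d \<in> D" for d
  proof -
    have "is_interval d" "d \<subseteq> i"
      using d(2,4)[OF that] by (auto simp: is_interval_cbox)
    then have "inj_on T d"
      using no_plateau_unit[OF P_subset_unit[OF assms]] mon[OF that] by (simp add: no_plateau_def)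
    then have "inj_on T {x \<in> d. T x = y}"
      by (rule inj_on_subset) auto
    moreover have "finite (T ` {x \<in> d. T x = y})"
      by (rule finite_subset[of _ "{y}"]) auto
    ultimately show ?thesis
      using finite_imageD by blast
  qed
  then have "finite (\<Union>d\<in>D. {x \<in> d. T x = y})"
    using d(1) by blast
  moreover have "{x \<in> i. T x = y} = (\<Union>d\<in>D. {x \<in> d. T x = y})"
    using d(6) by blast
  ultimately show ?thesis by simp
qed

definition branch_families :: "real set \<Rightarrow> real set \<Rightarrow> real set set set" where
  "branch_families i j = {C. finite C \<and>
     (\<forall>c\<in>C. is_interval c \<and> c \<subseteq> i \<and> monotone_map_on c T \<and> j \<subseteq> T ` c) \<and>
     (\<forall>c\<in>C. \<forall>d\<in>C. c \<noteq> d \<longrightarrow> interior c \<inter> interior d = {})}"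

text \<open>Each member covers \<open>j\<close> and so has a preimage of \<open>y\<close> in its
  interior; disjointness of the interiors makes these preimages distinct.\<close>

lemma card_branch_family_le:
  assumes "i \<in> P" "j \<in> P" "y \<in> interior j" "C \<in> branch_families i j"
  shows "card C \<le> card {x \<in> i. T x = y}"
proof -
  have C: "is_interval c" "c \<subseteq> i" "monotone_map_on c T" "j \<subseteq> T ` c" if "c \<in> C" for c
    using assms(4) that by (auto simp: branch_families_def)
  have "\<exists>x\<in>c. T x = y" if "c \<in> C" for c
    using C(4)[OF that] assms(3) interior_subset by blast
  then obtain h where h: "\<And>c. c \<in> C \<Longrightarrow> h c \<in> c \<and> T (h c) = y"
    by metis
  have "inj_on h C"
  proof (rule inj_onI, rule ccontr)
    fix c d assume cd: "c \<in> C" "d \<in> C" "h c = h d" "c \<noteq> d"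
    have "h e \<in> interior e" if "e \<in> C" for e
      using interior_if_covers[OF C(1)[OF that] C(3)[OF that] _ assms(2) C(4)[OF that]] h[OF that] assms(3)
      by simp
    then have "h c \<in> interior c" "h d \<in> interior d"
      using cd by blast+
    moreover have "interior c \<inter> interior d = {}"
      using assms(4) cd by (simp add: branch_families_def)
    ultimately show False
      using cd(3) by auto
  qed
  moreover have "h ` C \<subseteq> {x \<in> i. T x = y}"
    using h C(2) by blast
  ultimately show ?thesis
    using fiber_finite[OF assms(1)] by (rule card_inj_on_le)
qed

text \<open>The laps through the preimages of \<open>y\<close> form such a family. Injectivity of
  \<open>T\<close> on a lap gives different preimages different laps.\<close>

lemma ex_branch_family:
  assumes "i \<in> P" "j \<in> P" "y \<in> interior j"
  shows "\<exists>C\<in>branch_families i j. card C = card {x \<in> i. T x = y}"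
proof -
  let ?X = "{x \<in> i. T x = y}"
  have "\<exists>i'. max_monotone_interval T i i' \<and> x \<in> interior i' \<and> j \<subseteq> T ` i' \<and> inj_on T i'" if "x \<in> ?X" for x
  proof -
    have "x \<in> i" "T x \<in> interior j" using that assms(3) by auto
    then obtain i' where "max_monotone_interval T i i'" "x \<in> interior i'" "j \<subseteq> T ` i'" "inj_on T i'"
      using lap_at[OF assms(1,2)] by blast
    then show ?thesis by blast
  qed
  then obtain l where l: "\<And>x. x \<in> ?X \<Longrightarrow>
      max_monotone_interval T i (l x) \<and> x \<in> interior (l x) \<and> j \<subseteq> T ` l x \<and> inj_on T (l x)"
    by metis
  have "inj_on l ?X"
  proof (rule inj_onI)
    fix x x' assume x: "x \<in> ?X" "x' \<in> ?X" "l x = l x'"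
    then have "x \<in> l x" "x' \<in> l x"
      using l[of x] l[of x'] interior_subset by auto
    then show "x = x'"
      using l[OF x(1)] x by (auto dest: inj_onD)
  qed
  then have "card (l ` ?X) = card ?X"
    by (rule card_image)
  moreover have "l ` ?X \<in> branch_families i j"
  proof -
    have "interior c \<inter> interior d = {}" if "c \<in> l ` ?X" "d \<in> l ` ?X" "c \<noteq> d" for c d
      using that l by (intro max_monotone_intervals_disjoint[OF no_plateau_unit[OF P_subset_unit[OF assms(1)]]]) auto
    moreover have "is_interval c \<and> c \<subseteq> i \<and> monotone_map_on c T \<and> j \<subseteq> T ` c" if "c \<in> l ` ?X" for c
      using that l by (auto simp: max_monotone_interval_def)
    ultimately show ?thesis
      using fiber_finite[OF assms(1)] by (simp add: branch_families_def)
  qed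
  ultimately show ?thesis by blast
qed

text \<open>The two preceding bounds determine the maximum. In particular the size of the fiber is
  the same for all \<open>y\<close> in the interior of \<open>j\<close>.\<close>

lemma transition_matrix_fiber:
  assumes "i \<in> P" "j \<in> P" "y \<in> interior j"
  shows "transition_matrix T i j = card {x \<in> i. T x = y}"
proof (cases "j \<subseteq> T ` i")
  case True
  have "transition_matrix T i j = Max (card ` branch_families i j)"
    unfolding transition_matrix_def branch_families_def setcompr_eq_image using True by (rule if_P)
  also have "\<dots> = card {x \<in> i. T x = y}"
  proof (rule Max_eqI)
    have "card ` branch_families i j \<subseteq> {..card {x \<in> i. T x = y}}"
      using card_branch_family_le[OF assms] by blast
    then show "finite (card ` branch_families i j)"
      by (rule finite_subset) simp
    show "card {x \<in> i. T x = y} \<in> card ` branch_families i j"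
      using ex_branch_family[OF assms] by (metis imageI)
    show "n \<le> card {x \<in> i. T x = y}" if "n \<in> card ` branch_families i j" for n
      using that card_branch_family_le[OF assms] by blast
  qed
  finally show ?thesis .
next
  case False
  have "{x \<in> i. T x = y} = {}"
  proof (rule ccontr)
    assume "{x \<in> i. T x = y} \<noteq> {}"
    then obtain x where "x \<in> i" "T x \<in> interior j" using assms(3) by blast
    then obtain i' where "max_monotone_interval T i i'" "j \<subseteq> T ` i'"
      using lap_at[OF assms(1,2)] by blast
    then have "j \<subseteq> T ` i"
      by (auto simp: max_monotone_interval_def)
    with False show False ..
  qed
  then have "card {x \<in> i. T x = y} = 0" by (simp only: card.empty)
  then show ?thesis
    using False by (simp add: transition_matrix_def)
qed

abbreviation M :: "real set \<Rightarrow> real set \<Rightarrow> ennreal" where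
  "M i j \<equiv> of_nat (transition_matrix T i j)"

lemma ecard_fiber:
  assumes "i \<in> P" "j \<in> P" "y \<in> interior j"
  shows "ecard {x \<in> interior i. T x = y} = M i j"
proof -
  have "{x \<in> interior i. T x = y} = {x \<in> i. T x = y}"
    using preimage_interior_elem[OF assms(1,2)] assms(3) interior_subset by blast
  then show ?thesis
    using fiber_finite[OF assms(1)] by (simp add: transition_matrix_fiber[OF assms])
qed

text \<open>Splits by the element that contains \<open>T x\<close>. With \<open>I = P\<close> this
  is the recursion for matrix powers, with \<open>I = P - {j}\<close> the one for first
  entrances.\<close>

lemma ecard_step:
  assumes "i \<in> P" "I \<subseteq> P" "S \<subseteq> (\<Union>\<alpha>\<in>I. interior \<alpha>)"
  shows "ecard {x \<in> interior i. T x \<in> S} = (\<Sum>\<^sub>\<infinity>\<alpha>\<in>I. M i \<alpha> * ecard {z \<in> interior \<alpha>. z \<in> S})"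
proof -
  have I: "countable I"
    using assms(2) markov_conditions(1) by (rule countable_subset)
  have "{x \<in> interior i. T x \<in> S} = (\<Union>\<alpha>\<in>I. {x \<in> interior i. T x \<in> {z \<in> interior \<alpha>. z \<in> S}})"
    using assms(3) by blast
  moreover have "disjoint_family_on (\<lambda>\<alpha>. {x \<in> interior i. T x \<in> {z \<in> interior \<alpha>. z \<in> S}}) I"
    using P_eq_if_interior assms(2) unfolding disjoint_family_on_def by blast
  ultimately have "ecard {x \<in> interior i. T x \<in> S}
      = (\<integral>\<^sup>+\<alpha>. ecard {x \<in> interior i. T x \<in> {z \<in> interior \<alpha>. z \<in> S}} \<partial>count_space I)"
    using I by (simp only:) (rule emeasure_UN_countable; simp)
  also have "\<dots> = (\<integral>\<^sup>+\<alpha>. M i \<alpha> * ecard {z \<in> interior \<alpha>. z \<in> S} \<partial>count_space I)"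
    using assms(1,2) by (intro nn_integral_cong ecard_vimage_uniform ecard_fiber) auto
  finally show ?thesis
    by (simp add: nn_integral_infsum[OF I])
qed

section \<open>Counting preimages and branches of iterates\<close>

lemma interior_mem_unit: "i \<in> P \<Longrightarrow> x \<in> interior i \<Longrightarrow> x \<in> {0..1}"
  using P_subset_unit interior_subset by blast

lemma T_mem_unit: "x \<in> {0..1} \<Longrightarrow> T x \<in> {0..1}"
  using self_map by blast

lemma iterate_Suc_eq: "(T ^^ Suc n) x = (T ^^ n) (T x)"
  by (simp add: funpow_swap1)

text \<open>Backward orbits of interior points stay in interiors, so counting paths amounts to counting
  preimages of a single point.\<close>

lemma mat_power_count:
  assumes "i \<in> P" "j \<in> P" "y \<in> interior j"
  shows "ecard {x \<in> interior i. (T ^^ n) x = y} = mat_power P M n i j"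
  using assms(1)
proof (induction n arbitrary: i)
  case 0
  have "{x \<in> interior i. (T ^^ 0) x = y} = (if i = j then {y} else {})"
    using assms(3) P_eq_if_interior[OF 0 assms(2)] by auto
  then show ?case by simp
next
  case (Suc n)
  \<comment> \<open>The restriction to the unit interval matters: elsewhere \<open>T\<close> is
    arbitrary and preimages of \<open>y\<close> need not lie in partition elements.\<close>
  define S where "S = {z \<in> {0..1}. (T ^^ n) z = y}"
  have "{x \<in> interior i. (T ^^ Suc n) x = y} = {x \<in> interior i. T x \<in> S}"
    unfolding iterate_Suc_eq S_def using T_mem_unit interior_mem_unit[OF Suc.prems] by blast
  moreover have "S \<subseteq> (\<Union>\<alpha>\<in>P. interior \<alpha>)"
    using iterate_preimage_interior[OF _ assms(2)] assms(3) by (auto simp: S_def)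
  ultimately have "ecard {x \<in> interior i. (T ^^ Suc n) x = y}
      = (\<Sum>\<^sub>\<infinity>\<alpha>\<in>P. M i \<alpha> * ecard {z \<in> interior \<alpha>. z \<in> S})"
    using ecard_step[OF Suc.prems order_refl] by simp
  also have "\<dots> = (\<Sum>\<^sub>\<infinity>\<alpha>\<in>P. M i \<alpha> * mat_power P M n \<alpha> j)"
  proof (intro infsum_cong arg_cong2[of _ _ _ _ "(*)"] refl)
    fix \<alpha> assume "\<alpha> \<in> P"
    then have "{z \<in> interior \<alpha>. z \<in> S} = {z \<in> interior \<alpha>. (T ^^ n) z = y}"
      using interior_mem_unit unfolding S_def by blast
    with Suc.IH[OF \<open>\<alpha> \<in> P\<close>] show "ecard {z \<in> interior \<alpha>. z \<in> S} = mat_power P M n \<alpha> j" by simp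
  qed
  finally show ?case by simp
qed

lemma all_less_Suc_Suc_iff:
  "(\<forall>k. 0 < k \<and> k < Suc (Suc n) \<longrightarrow> Q k) \<longleftrightarrow> Q (Suc 0) \<and> (\<forall>k. 0 < k \<and> k < Suc n \<longrightarrow> Q (Suc k))"
proof -
  have "Q k" if "Q (Suc 0)" "\<forall>k. 0 < k \<and> k < Suc n \<longrightarrow> Q (Suc k)" "0 < k" "k < Suc (Suc n)" for k
    using that by (cases k; cases "k = 1") auto
  then show ?thesis by auto
qed

text \<open>The recursion for matrix powers with one change: the point after the first step must
  avoid the interior of \<open>j\<close>, which removes \<open>j\<close> from the sum.\<close>

lemma first_entrance_count:
  assumes "i \<in> P" "j \<in> P" "y \<in> interior j"
  shows "ecard {x \<in> interior i. (T ^^ Suc n) x = y \<and> (\<forall>k. 0 < k \<and> k < Suc n \<longrightarrow> (T ^^ k) x \<notin> interior j)}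
    = first_entrance P M (Suc n) i j"
  using assms(1)
proof (induction n arbitrary: i)
  case 0
  have "{x \<in> interior i. (T ^^ Suc 0) x = y \<and> (\<forall>k. 0 < k \<and> k < Suc 0 \<longrightarrow> (T ^^ k) x \<notin> interior j)}
      = {x \<in> interior i. T x = y}"
    by auto
  then show ?case
    using ecard_fiber[OF 0 assms(2,3)] by simp
next
  case (Suc n)
  define S where "S = {z \<in> {0..1}. z \<notin> interior j \<and> (T ^^ Suc n) z = y \<and>
    (\<forall>k. 0 < k \<and> k < Suc n \<longrightarrow> (T ^^ k) z \<notin> interior j)}"
  have "{x \<in> interior i. (T ^^ Suc (Suc n)) x = y \<and> (\<forall>k. 0 < k \<and> k < Suc (Suc n) \<longrightarrow> (T ^^ k) x \<notin> interior j)}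
      = {x \<in> interior i. T x \<in> S}"
    unfolding all_less_Suc_Suc_iff iterate_Suc_eq[of "Suc n"] S_def
    using T_mem_unit interior_mem_unit[OF Suc.prems] by (auto simp: iterate_Suc_eq simp del: funpow.simps(2))
  moreover have "S \<subseteq> (\<Union>\<alpha>\<in>P - {j}. interior \<alpha>)"
  proof
    fix z assume z: "z \<in> S"
    then obtain \<alpha> where "\<alpha> \<in> P" "z \<in> interior \<alpha>"
      using iterate_preimage_interior[OF _ assms(2), of z "Suc n"] assms(3) by (auto simp: S_def)
    with z show "z \<in> (\<Union>\<alpha>\<in>P - {j}. interior \<alpha>)"
      by (auto simp: S_def)
  qed
  ultimately have "ecard {x \<in> interior i. (T ^^ Suc (Suc n)) x = y
        \<and> (\<forall>k. 0 < k \<and> k < Suc (Suc n) \<longrightarrow> (T ^^ k) x \<notin> interior j)}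
      = (\<Sum>\<^sub>\<infinity>\<alpha>\<in>P - {j}. M i \<alpha> * ecard {z \<in> interior \<alpha>. z \<in> S})"
    using ecard_step[OF Suc.prems, of "P - {j}" S] by simp
  also have "\<dots> = (\<Sum>\<^sub>\<infinity>\<alpha>\<in>P - {j}. M i \<alpha> * first_entrance P M (Suc n) \<alpha> j)"
  proof (intro infsum_cong arg_cong2[of _ _ _ _ "(*)"] refl)
    fix \<alpha> assume \<alpha>: "\<alpha> \<in> P - {j}"
    then have "{z \<in> interior \<alpha>. z \<in> S} = {x \<in> interior \<alpha>. (T ^^ Suc n) x = y \<and>
        (\<forall>k. 0 < k \<and> k < Suc n \<longrightarrow> (T ^^ k) x \<notin> interior j)}"
      using interior_mem_unit P_eq_if_interior[OF _ assms(2)] unfolding S_def by blast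
    with Suc.IH[of \<alpha>] \<alpha> show "ecard {z \<in> interior \<alpha>. z \<in> S} = first_entrance P M (Suc n) \<alpha> j" by simp
  qed
  finally show ?case by simp
qed

text \<open>The interior of \<open>j\<close> is pulled back along the orbit of \<open>x\<close>,
  each time inside a lap that covers the next element. All points of \<open>C\<close> therefore pass
  through the same elements up to time \<open>p\<close>.\<close>

lemma branch_at:
  assumes "i \<in> P" "j \<in> P" "x \<in> interior i" "(T ^^ p) x \<in> interior j"
  shows "\<exists>C. is_interval C \<and> x \<in> C \<and> C \<subseteq> interior i \<and> inj_on (T ^^ p) C \<and> (T ^^ p) ` C = interior j \<and>
    (\<forall>k\<le>p. \<exists>\<alpha>\<in>P. (T ^^ k) ` C \<subseteq> interior \<alpha>)"
  using assms(1,3,4)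
proof (induction p arbitrary: i x)
  case 0
  then have "i = j" using assms(2) P_eq_if_interior by auto
  obtain a b where "interior i = {a<..<b}" using 0(1) by (rule P_interval)
  then have "is_interval (interior i)" by (simp add: is_interval_oo)
  with 0 \<open>i = j\<close> show ?case by (intro exI[of _ "interior i"]) auto
next
  case (Suc p)
  have "T x \<in> {0..1}" "(T ^^ p) (T x) \<in> interior j"
    using Suc.prems interior_mem_unit T_mem_unit unfolding iterate_Suc_eq by blast+
  then obtain \<alpha> where \<alpha>: "\<alpha> \<in> P" "T x \<in> interior \<alpha>"
    using iterate_preimage_interior assms(2) by blast
  obtain C where C: "is_interval C" "T x \<in> C" "C \<subseteq> interior \<alpha>" "inj_on (T ^^ p) C" "(T ^^ p) ` C = interior j"
    "\<And>k. k \<le> p \<Longrightarrow> \<exists>\<beta>\<in>P. (T ^^ k) ` C \<subseteq> interior \<beta>"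
    using Suc.IH[OF \<alpha>] \<open>(T ^^ p) (T x) \<in> interior j\<close> by blast
  have "x \<in> i" using Suc.prems interior_subset by blast
  then obtain i' where i': "max_monotone_interval T i i'" "x \<in> interior i'" "\<alpha> \<subseteq> T ` i'" "inj_on T i'"
    using lap_at[OF Suc.prems(1) \<alpha>(1) _ \<alpha>(2)] by blast
  then have m: "is_interval i'" "monotone_map_on i' T" "i' \<subseteq> i"
    by (auto simp: max_monotone_interval_def)
  define B where "B = {x \<in> i'. T x \<in> C}"
  have TB: "T ` B = C"
    using C(3) i'(3) interior_subset[of \<alpha>] by (auto simp: B_def)
  have "is_interval B"
    unfolding B_def by (rule is_interval_monotone_preimage[OF m(1,2) C(1)])
  moreover have "x \<in> B"
    using i'(2) interior_subset C(2) by (auto simp: B_def)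
  moreover have Bi: "B \<subseteq> interior i"
    using preimage_interior_elem[OF Suc.prems(1) \<alpha>(1)] m(3) C(3) by (auto simp: B_def)
  moreover have "inj_on (T ^^ Suc p) B"
  proof -
    have "inj_on T B"
      using i'(4) by (rule inj_on_subset) (auto simp: B_def)
    then have "inj_on ((T ^^ p) \<circ> T) B"
      using C(4) by (intro comp_inj_on) (simp_all add: TB)
    then show ?thesis by (simp only: funpow_Suc_right)
  qed
  moreover have img: "(T ^^ Suc k) ` B = (T ^^ k) ` C" for k
    unfolding TB[symmetric] image_image iterate_Suc_eq ..
  moreover have "\<exists>\<alpha>\<in>P. (T ^^ k) ` B \<subseteq> interior \<alpha>" if "k \<le> Suc p" for k
  proof (cases k)
    case 0
    then show ?thesis using Bi Suc.prems(1) by auto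
  next
    case (Suc k')
    then show ?thesis using C(6)[of k'] that by (simp only: img)
  qed
  ultimately show ?case
    using C(5) by (intro exI[of _ B]) (simp del: funpow.simps(2))
qed

text \<open>The middle one of three preimages of a point in an interval lies in a branch that is
  confined to that interval.\<close>

lemma branch_inside:
  assumes "i \<in> P" "{u<..<v} \<subseteq> interior i" "u < v"
  obtains C p c d s where "0 < p" "u < c" "c \<le> d" "d < v" "C \<subseteq> {c..d}" "(T ^^ p) ` C = interior i"
    "\<And>x. x \<in> C \<Longrightarrow> visits T (interior i) x p = s"
proof -
  obtain a b where ab: "0 \<le> a" "a < b" "b \<le> 1" "interior i = {a<..<b}"
    using assms(1) by (rule P_interval)
  have "a \<le> u \<and> v \<le> b"
    using assms(2,3) unfolding ab(4) by (simp add: greaterThanLessThan_subseteq_greaterThanLessThan)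
  then have uv: "0 \<le> u" "v \<le> 1" using ab by auto
  \<comment> \<open>The midpoint lies in the interior of \<open>i\<close> and strictly between 0 and
    1, as the covering property requires.\<close>
  define y where "y = (a + b) / 2"
  have y: "0 < y" "y < 1" "y \<in> interior i"
    using ab by (auto simp: y_def field_simps)
  define w1 w2 where "w1 = u + (v - u) / 3" and "w2 = u + 2 * (v - u) / 3"
  have w: "u < w1" "w1 < w2" "w2 < v"
    using assms(3) by (auto simp: w1_def w2_def field_simps)
  obtain N1 where N1: "\<And>n. n \<ge> N1 \<Longrightarrow> {y..y} \<subseteq> (T ^^ n) ` {u<..<w1}"
    using eventually_covers[of u w1 y y] uv w y by auto
  obtain N2 where N2: "\<And>n. n \<ge> N2 \<Longrightarrow> {y..y} \<subseteq> (T ^^ n) ` {w1<..<w2}"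
    using eventually_covers[of w1 w2 y y] uv w y by auto
  obtain N3 where N3: "\<And>n. n \<ge> N3 \<Longrightarrow> {y..y} \<subseteq> (T ^^ n) ` {w2<..<v}"
    using eventually_covers[of w2 v y y] uv w y by auto
  \<comment> \<open>Large enough for all three thirds of the interval to contain a preimage of
    \<open>y\<close>, and positive.\<close>
  define p where "p = Suc (max N1 (max N2 N3))"
  obtain x1 where x1: "u < x1" "x1 < w1" "(T ^^ p) x1 = y" using N1[of p] by (force simp: p_def)
  obtain x2 where x2: "w1 < x2" "x2 < w2" "(T ^^ p) x2 = y" using N2[of p] by (force simp: p_def)
  obtain x3 where x3: "w2 < x3" "x3 < v" "(T ^^ p) x3 = y" using N3[of p] by (force simp: p_def)
  have "x2 \<in> interior i" using assms(2) x2 w by auto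
  then obtain C where C: "is_interval C" "x2 \<in> C" "C \<subseteq> interior i" "inj_on (T ^^ p) C" "(T ^^ p) ` C = interior i"
    "\<And>k. k \<le> p \<Longrightarrow> \<exists>\<alpha>\<in>P. (T ^^ k) ` C \<subseteq> interior \<alpha>"
    using branch_at[OF assms(1,1), of x2 p] x2(3) y(3) by blast
  \<comment> \<open>\<open>T ^^ p\<close> is injective on \<open>C\<close> and takes the value
    \<open>y\<close> at all three points. As an interval through \<open>x2\<close>, \<open>C\<close>
    is trapped between \<open>x1\<close> and \<open>x3\<close>.\<close>
  have "x1 \<notin> C" "x3 \<notin> C"
    using C(2,4) x1 x2 x3 by (metis inj_onD less_asym less_trans)+
  then have "C \<subseteq> {x1..x3}"
    using C(1,2) x1 x2 x3 unfolding is_interval_1 by (smt (verit) atLeastAtMost_iff subsetI)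
  have "visits T (interior i) x p = visits T (interior i) x2 p" if "x \<in> C" for x
  proof -
    have "(T ^^ k) x \<in> interior i \<longleftrightarrow> (T ^^ k) x2 \<in> interior i" if k: "k < p" for k
    proof -
      obtain \<alpha> where "\<alpha> \<in> P" "(T ^^ k) ` C \<subseteq> interior \<alpha>" using C(6)[of k] k by auto
      then have "\<alpha> \<in> P" "(T ^^ k) x \<in> interior \<alpha>" "(T ^^ k) x2 \<in> interior \<alpha>"
        using \<open>x \<in> C\<close> C(2) by auto
      then show ?thesis using P_eq_if_interior assms(1) by metis
    qed
    then have "{k. k < p \<and> (T ^^ k) x \<in> interior i} = {k. k < p \<and> (T ^^ k) x2 \<in> interior i}" by auto
    then show ?thesis by (simp add: visits_def)
  qed
  with \<open>C \<subseteq> {x1..x3}\<close> C(5) x1 x2 x3 show thesis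
    by (intro that[of p x1 x3 C "visits T (interior i) x2 p"]) (auto simp: p_def)
qed

text \<open>An element touching \<open>0\<close> or \<open>1\<close> need not be covered by the image of a compact set directly,
  but it is the image of a branch that is.\<close>

lemma interior_eventually_covered:
  assumes "i \<in> P" "0 \<le> a" "a < b" "b \<le> 1"
  shows "\<exists>N. \<forall>n\<ge>N. interior i \<subseteq> (T ^^ n) ` {a<..<b}"
proof -
  obtain u v where uv: "0 \<le> u" "u < v" "v \<le> 1" "interior i = {u<..<v}"
    using assms(1) by (rule P_interval)
  have "{u<..<v} \<subseteq> interior i" by (simp add: uv(4))
  then obtain C p c d s where C: "u < c" "c \<le> d" "d < v" "C \<subseteq> {c..d}" "(T ^^ p) ` C = interior i"
    using uv(2) by (rule branch_inside[OF assms(1)])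
  obtain N where N: "\<And>n. n \<ge> N \<Longrightarrow> {c..d} \<subseteq> (T ^^ n) ` {a<..<b}"
    using eventually_covers[of a b c d] assms uv C by auto
  have "interior i \<subseteq> (T ^^ n) ` {a<..<b}" if "n \<ge> N + p" for n
  proof -
    define m where "m = n - p"
    have m: "n = m + p" "N \<le> m"
      using that by (auto simp: m_def)
    have "interior i = (T ^^ p) ` C"
      by (rule C(5)[symmetric])
    also have "\<dots> \<subseteq> (T ^^ p) ` ((T ^^ m) ` {a<..<b})"
      by (intro image_mono order_trans[OF C(4) N[OF m(2)]])
    also have "\<dots> = (T ^^ n) ` {a<..<b}"
      unfolding m(1) image_image funpow_add_apply[symmetric] ..
    finally show ?thesis .
  qed
  then show ?thesis by blast
qed

section \<open>Interiors of elements as return systems and the comparison of two partitions\<close>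

lemma interior_return_system:
  assumes "i \<in> P"
  shows "return_system T (interior i) (\<lambda>n. mat_power P M n i i) (\<lambda>n. first_entrance P M n i i)"
proof
  obtain a b where ab: "0 \<le> a" "a < b" "b \<le> 1" "interior i = {a<..<b}"
    using assms by (rule P_interval)
  then show "interior i \<noteq> {}" by simp
  obtain N where N: "\<And>n. n \<ge> N \<Longrightarrow> interior i \<subseteq> (T ^^ n) ` interior i"
    using interior_eventually_covered[OF assms ab(1-3)] ab(4) by auto
  have "interior i \<subseteq> (T ^^ Suc N) ` interior i"
    by (rule N) simp
  then show "\<exists>n>0. interior i \<subseteq> (T ^^ n) ` interior i"
    by (intro exI[of _ "Suc N"] conjI zero_less_Suc)
  fix n y assume y: "y \<in> interior i"
  show "ecard {x \<in> interior i. (T ^^ n) x = y} = mat_power P M n i i"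
    by (rule mat_power_count[OF assms assms y])
  show "ecard {x. returns T (interior i) 1 x n \<and> (T ^^ n) x = y} = first_entrance P M n i i"
  proof (cases n)
    case 0
    then show ?thesis by (simp add: returns_1_iff del: One_nat_def)
  next
    case (Suc m)
    have "{x. returns T (interior i) 1 x n \<and> (T ^^ n) x = y}
        = {x \<in> interior i. (T ^^ Suc m) x = y \<and> (\<forall>k. 0 < k \<and> k < Suc m \<longrightarrow> (T ^^ k) x \<notin> interior i)}"
      using y unfolding returns_1_iff Suc by blast
    then show ?thesis
      using first_entrance_count[OF assms assms y, of m] Suc by simp
  qed
qed

end

text \<open>By mixing some point of the interior of \<open>i\<close> enters \<open>{a<..<b}\<close>
  at a time \<open>q\<close>, and by continuity so does a neighbourhood of it. A branch returning
  onto the interior of \<open>i\<close> is then found inside this neighbourhood.\<close>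

lemma full_return_through_interior:
  assumes "markov_map T P" "i \<in> P" "0 \<le> a" "a < b" "b \<le> 1"
  shows "full_return_through T (interior i) {a<..<b}"
proof -
  interpret markov_map T P by fact
  obtain u v where uv: "0 \<le> u" "u < v" "v \<le> 1" "interior i = {u<..<v}"
    using assms(2) by (rule P_interval)
  obtain q x where x: "x \<in> {u<..<v}" "(T ^^ q) x \<in> {a<..<b}"
    using eventually_hits[of u v a b] uv assms by blast
  have "continuous_on {u<..<v} (T ^^ q)"
    using uv by (intro continuous_on_subset[OF iterate_continuous]) auto
  then have "open ({u<..<v} \<inter> (T ^^ q) -` {a<..<b})"
    by (intro continuous_open_preimage) auto
  then obtain e where e: "0 < e" "ball x e \<subseteq> {u<..<v} \<inter> (T ^^ q) -` {a<..<b}"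
    using x by (metis IntI open_contains_ball vimageI)
  then have sub: "{x - e<..<x + e} \<subseteq> {u<..<v}" "(T ^^ q) ` {x - e<..<x + e} \<subseteq> {a<..<b}"
    by (auto simp: ball_eq_greaterThanLessThan)
  have sub': "{x - e<..<x + e} \<subseteq> interior i" "x - e < x + e"
    using sub(1) e(1) by (simp_all add: uv(4))
  obtain C p c d s where C: "0 < p" "x - e < c" "d < x + e" "C \<subseteq> {c..d}" "(T ^^ p) ` C = interior i"
    "\<And>x. x \<in> C \<Longrightarrow> visits T (interior i) x p = s"
    by (rule branch_inside[OF assms(2) sub'(1,2)]) (rule that)
  have "C \<subseteq> {x - e<..<x + e}"
    using C(2-4) by force
  then have "C \<subseteq> interior i" "(T ^^ q) ` C \<subseteq> {a<..<b}"
    by (rule order_trans[OF _ sub'(1)], rule order_trans[OF image_mono sub(2)])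
  with C(1,5,6) show ?thesis
    unfolding full_return_through_def by metis
qed

lemma return_systems_interior:
  assumes "markov_map T P" "markov_map T Q" "i \<in> P" "j \<in> Q"
  shows "return_systems T (interior i) (interior j)
    (\<lambda>n. mat_power P (\<lambda>i j. of_nat (transition_matrix T i j)) n i i)
    (\<lambda>n. mat_power Q (\<lambda>i j. of_nat (transition_matrix T i j)) n j j)
    (\<lambda>n. first_entrance P (\<lambda>i j. of_nat (transition_matrix T i j)) n i i)
    (\<lambda>n. first_entrance Q (\<lambda>i j. of_nat (transition_matrix T i j)) n j j)"
proof -
  interpret P: markov_map T P by fact
  interpret Q: markov_map T Q by fact
  obtain a b where ab: "0 \<le> a" "a < b" "b \<le> 1" "interior i = {a<..<b}"
    using assms(3) by (rule P.P_interval)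
  obtain c d where cd: "0 \<le> c" "c < d" "d \<le> 1" "interior j = {c<..<d}"
    using assms(4) by (rule Q.P_interval)
  have "\<exists>k. interior j \<subseteq> (T ^^ k) ` interior i" "\<exists>k. interior i \<subseteq> (T ^^ k) ` interior j"
    using Q.interior_eventually_covered[OF assms(4) ab(1-3)] P.interior_eventually_covered[OF assms(3) cd(1-3)]
    unfolding ab(4) cd(4) by (meson order_refl)+
  then show ?thesis
    using P.interior_return_system[OF assms(3)] Q.interior_return_system[OF assms(4)]
    by (simp add: return_systems_def return_systems_axioms_def)
qed

lemma vj_type_markov_map:
  assumes "markov_map T P" "markov_map T Q" "i \<in> P" "j \<in> Q"
  shows "vj_type (\<lambda>n. mat_power P (\<lambda>i j. of_nat (transition_matrix T i j)) n i i)
      (\<lambda>n. first_entrance P (\<lambda>i j. of_nat (transition_matrix T i j)) n i i) c \<longleftrightarrow>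
    vj_type (\<lambda>n. mat_power Q (\<lambda>i j. of_nat (transition_matrix T i j)) n j j)
      (\<lambda>n. first_entrance Q (\<lambda>i j. of_nat (transition_matrix T i j)) n j j) c"
proof -
  obtain a b where ab: "0 \<le> a" "a < b" "b \<le> 1" "interior i = {a<..<b}"
    using assms(1,3) markov_map.P_interval by metis
  obtain c d where cd: "0 \<le> c" "c < d" "d \<le> 1" "interior j = {c<..<d}"
    using assms(2,4) markov_map.P_interval by metis
  show ?thesis
    using return_systems.vj_type_eq_return_systems[OF return_systems_interior[OF assms]]
      full_return_through_interior[OF assms(1,3) cd(1-3)] full_return_through_interior[OF assms(2,4) ab(1-3)]
    unfolding ab(4) cd(4) .
qed

lemma markov_map_CPMM:
  assumes "T \<in> CPMM" "markov_partition T P"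
  shows "markov_map T P"
proof
  show "slack_markov_partition T P"
    using assms(2) classical_imp_slack by (auto simp: markov_partition_def)
qed (use assms(1) in \<open>auto simp: CPMM_def\<close>)

theorem proposition9:
  fixes T :: "real \<Rightarrow> real" and P Q :: "real set set"
  assumes "T \<in> CPMM"
    and "markov_partition T P"
    and "markov_partition T Q"
  shows "\<exists>c. belongs_to_class P (\<lambda>i j. of_nat (transition_matrix T i j)) c \<and>
             belongs_to_class Q (\<lambda>i j. of_nat (transition_matrix T i j)) c"
proof -
  have P: "markov_map T P" and Q: "markov_map T Q"
    using assms markov_map_CPMM by auto
  obtain i0 j0 where i0: "i0 \<in> P" and j0: "j0 \<in> Q"
    using markov_map.P_nonempty[OF P] markov_map.P_nonempty[OF Q] by blast
  obtain c where "vj_type (\<lambda>n. mat_power Q (\<lambda>i j. of_nat (transition_matrix T i j)) n j0 j0)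
      (\<lambda>n. first_entrance Q (\<lambda>i j. of_nat (transition_matrix T i j)) n j0 j0) c"
    using vj_type_exists return_system.is_renewal_pair markov_map.interior_return_system[OF Q j0] by blast
  \<comment> \<open>All \<open>i\<close> in \<open>P\<close> are compared with the one index
    \<open>j0\<close>, and then all indices in \<open>Q\<close> with \<open>i0\<close>; this
    includes the independence of the class from the index.\<close>
  then have "belongs_to_class P (\<lambda>i j. of_nat (transition_matrix T i j)) c"
    unfolding belongs_to_class_iff_vj_type using vj_type_markov_map[OF P Q _ j0] by blast
  moreover from this have "belongs_to_class Q (\<lambda>i j. of_nat (transition_matrix T i j)) c"
    unfolding belongs_to_class_iff_vj_type using vj_type_markov_map[OF P Q i0] i0 by blast
  ultimately show ?thesis by blast
qed

end
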